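(* Let $0<m\le L<\infty$, let $\ell\ge0$ be an integer, and let $\mathcal{A}=(A,B,C)$ be an algorithm with state dimension $n$ satisfying the algorithm-form assumption, applied to functions $f\in F_{m,L}$ with additive gradient noise satisfying the noise assumption. With the matrices $Z,Z_+,\mathbf{A},\mathbf{B},\mathbf{H},\mathbf{C},\mathbf{D},\mathbf{X},\mathbf{Y}$ and the maps $\Pi,\pi$ given in the context: (1) If there exist $r>0$, $P=P^{\mathsf T}\in\mathbb{R}^{(n+2\ell)\times(n+2\ell)}$, $p\in\mathbb{R}^\ell$, and elementwise nonnegative $\Lambda_1,\Lambda_2\in\mathbb{R}^{(\ell+2)\times(\ell+2)}$ such that $$\begin{bmatrix}\mathbf{A}&\mathbf{B}\\ I&0\end{bmatrix}^{\mathsf T}\begin{bmatrix}P&0\\ 0&-r^2P\end{bmatrix}\begin{bmatrix}\mathbf{A}&\mathbf{B}\\ I&0\end{bmatrix}+\begin{bmatrix}\mathbf{C}&\mathbf{D}\end{bmatrix}^{\mathsf T}\Pi(\Lambda_1)\begin{bmatrix}\mathbf{C}&\mathbf{D}\end{bmatrix}\preceq0,$$ $$(Z_+-r^2Z)^{\mathsf T}p+\pi(\Lambda_1)\le0,$$ $$\mathbf{X}^{\mathsf T}\mathbf{X}-\begin{bmatrix}I&0\end{bmatrix}^{\mathsf T}P\begin{bmatrix}I&0\end{bmatrix}+\begin{bmatrix}\mathbf{C}&\mathbf{D}\end{bmatrix}^{\mathsf T}\Pi(\Lambda_2)\begin{bmatrix}\mathbf{C}&\mathbf{D}\end{bmatrix}\preceq0,$$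 $$-Z^{\mathsf T}p+\pi(\Lambda_2)\le0,$$ then $\mathrm{rate}(\mathcal{A},F_{m,L})\le r$. (2) If there exist $P=P^{\mathsf T}\in\mathbb{R}^{(n+2\ell)\times(n+2\ell)}$, $p\in\mathbb{R}^\ell$, and elementwise nonnegative $\Lambda_1,\Lambda_2\in\mathbb{R}^{(\ell+2)\times(\ell+2)}$ such that $$\begin{bmatrix}\mathbf{A}&\mathbf{B}\\ I&0\end{bmatrix}^{\mathsf T}\begin{bmatrix}P&0\\ 0&-P\end{bmatrix}\begin{bmatrix}\mathbf{A}&\mathbf{B}\\ I&0\end{bmatrix}+\begin{bmatrix}\mathbf{C}&\mathbf{D}\end{bmatrix}^{\mathsf T}\Pi(\Lambda_1)\begin{bmatrix}\mathbf{C}&\mathbf{D}\end{bmatrix}+\mathbf{Y}^{\mathsf T}\mathbf{Y}\preceq0,$$ $$(Z_+-Z)^{\mathsf T}p+\pi(\Lambda_1)\le0,$$ $$-\begin{bmatrix}I&0\end{bmatrix}^{\mathsf T}P\begin{bmatrix}I&0\end{bmatrix}+\begin{bmatrix}\mathbf{C}&\mathbf{D}\end{bmatrix}^{\mathsf T}\Pi(\Lambda_2)\begin{bmatrix}\mathbf{C}&\mathbf{D}\end{bmatrix}\preceq0,$$ $$-Z^{\mathsf T}p+\pi(\Lambda_2)\le0,$$ then $\mathrm{sens}(\mathcal{A},F_{m,L})\le\sqrt{\mathbf{H}^{\mathsf T}P\mathbf{H}}$.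
   Context: Points of $\mathbb{R}^d$ are written as row vectors in $\mathbb{R}^{1\times d}$, $\nabla f:\mathbb{R}^{1\times d}\to\mathbb{R}^{1\times d}$, and $\|\cdot\|$ is the Frobenius norm. Inequalities between vectors are elementwise; $\preceq$ is the semidefinite order. Function class $F_{m,L}$: continuously differentiable $f:\mathbb{R}^d\to\mathbb{R}$ such that for all $x,y\in\mathbb{R}^d$, $f(y)\ge f(x)+\langle\nabla f(x),y-x\rangle+\frac m2\|y-x\|^2$ and $\|\nabla f(x)-\nabla f(y)\|\le L\|x-y\|$. $y^\star$ denotes the unique minimizer of $f$. Algorithms: $\mathcal{A}=(A,B,C)$ with $A\in\mathbb{R}^{n\times n}$, $B\in\mathbb{R}^{n\times1}$, $C\in\mathbb{R}^{1\times n}$ denotes the iteration $\xi^{t+1}=A\xi^t+B(u^t+w^t)$, $y^t=C\xi^t$, $u^t=\nabla f(y^t)$, where $\xi^t\in\mathbb{R}^{n\times d}$ is the state and $w^t\in\mathbb{R}^{1\times d}$ the noise. Algorithm-form assumption: $A$ has an eigenvalue at $1$, and the associated eigenvector $v\in\mathbb{R}^n$ satisfies $Cv\ne0$. Consequently there is a fixed point $\xi^\star$ with $\xi^\star=A\xi^\star$, $y^\star=C\xi^\star$. Convergence rate (computed with $w^t=0$ for all $t$): for a function class $\mathcal{F}$, $$\mathrm{rate}(\mathcal{A},\mathcal{F})=\inf\Bigl\{r>0:\ \sup_{f\in\mathcal{F}}\sup_{\xi^0\in\mathbb{R}^{n\times d}}\sup_{t\ge0}\frac{\|\xi^t-\xi^\star\|}{r^t\|\xi^0-\xi^\star\|}<\infty\Bigr\}.$$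 Noise assumption (with parameter $\sigma>0$): the joint distribution $\mathbb{P}$ of $w^0,w^1,\dots$ lies in $\mathcal{P}_\sigma$, the set of all joint distributions for which the $w^t$ are independent across $t$ (not necessarily identically distributed), $\mathbb{E}\,w^t=0$, and $\mathbb{E}\|w^t\|^2\le\sigma^2$ for all $t$. Sensitivity: $$\mathrm{sens}(\mathcal{A},\mathcal{F})=\sup_{f\in\mathcal{F}}\sup_{\xi^0\in\mathbb{R}^{n\times d}}\sup_{\mathbb{P}\in\mathcal{P}_\sigma}\limsup_{T\to\infty}\sqrt{\mathbb{E}_{w\sim\mathbb{P}}\frac{1}{\sigma^2T}\sum_{t=0}^{T-1}\|y^t-y^\star\|^2}.$$ Matrices. Let $\mathsf{e}_1=(1,0,\dots,0)^{\mathsf T}\in\mathbb{R}^{\ell+1}$ and define $Z_+,Z\in\mathbb{R}^{\ell\times(\ell+1)}$ by $Z_+=\begin{bmatrix}I_\ell&0_{\ell\times1}\end{bmatrix}$, $Z=\begin{bmatrix}0_{\ell\times1}&I_\ell\end{bmatrix}$. Define $$\mathbf{A}=\begin{bmatrix}A&0&0\\ Z_+\mathsf{e}_1C&Z_+Z^{\mathsf T}&0\\ 0&0&Z_+Z^{\mathsf T}\end{bmatrix},\quad\mathbf{B}=\begin{bmatrix}B\\ 0\\ Z_+\mathsf{e}_1\end{bmatrix},\quad\mathbf{H}=\begin{bmatrix}B\\ 0\\ 0\end{bmatrix},\quad\mathbf{C}=\begin{bmatrix}\mathsf{e}_1C&Z^{\mathsf T}&0\\ 0&0&Z^{\mathsf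 T}\end{bmatrix},\quad\mathbf{D}=\begin{bmatrix}0\\ \mathsf{e}_1\end{bmatrix},$$ $$\mathbf{X}=\begin{bmatrix}I_n&0_{n\times(2\ell+1)}\end{bmatrix},\qquad\mathbf{Y}=\begin{bmatrix}C&0_{1\times(2\ell+1)}\end{bmatrix}.$$ Here $\mathbf{A}$ is $(n+2\ell)\times(n+2\ell)$, and $\begin{bmatrix}I&0\end{bmatrix}$ is $(n+2\ell)\times(n+2\ell+1)$ with $I=I_{n+2\ell}$. When $\ell=0$ the empty blocks are omitted. Multipliers. Let $\mathcal{I}=\{1,\dots,\ell+1,\star\}$, let $\mathsf{e}_i$ be the $i$th unit vector of $\mathbb{R}^{\ell+1}$ for $i\in\{1,\dots,\ell+1\}$, and $\mathsf{e}_\star=0\in\mathbb{R}^{\ell+1}$. For $\Lambda\in\mathbb{R}^{(\ell+2)\times(\ell+2)}$ (rows and columns indexed by $\mathcal{I}$), $$\Pi(\Lambda)=\sum_{i,j\in\mathcal{I}}\Lambda_{ij}\begin{bmatrix}-mL(\mathsf{e}_i-\mathsf{e}_j)(\mathsf{e}_i-\mathsf{e}_j)^{\mathsf T}&(\mathsf{e}_i-\mathsf{e}_j)(m\mathsf{e}_i-L\mathsf{e}_j)^{\mathsf T}\\ (m\mathsf{e}_i-L\mathsf{e}_j)(\mathsf{e}_i-\mathsf{e}_j)^{\mathsf T}&-(\mathsf{e}_i-\mathsf{e}_j)(\mathsf{e}_i-\mathsf{e}_j)^{\mathsf T}\end{bmatrix},\qquad\pi(\Lambda)=2(L-m)\sum_{i,j\in\mathcal{I}}\Lambda_{ij}(\mathsf{e}_i-\mathsf{e}_j).$$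 *)

theory Defs
  imports "HOL-Probability.Probability" "Jordan_Normal_Form.Char_Poly"
begin

unbundle no vec_syntax
no_notation inner (infix \<open>\<bullet>\<close> 70)

text \<open>
  Points of \<open>\<real>\<^sup>d\<close> have type \<open>real ^ 'd\<close>. The matrices \<open>A\<close>, \<open>B\<close>, \<open>C\<close> and all matrices built from them
  are variable-size \<open>real mat\<close>, so that \<open>l = 0\<close> simply gives blocks without rows or columns.
  A state in \<open>\<real>\<^bsup>n \<times> d\<^esup>\<close> is given by its \<open>n\<close> rows, as a function \<open>nat \<Rightarrow> real ^ 'd\<close> of which only the
  values at \<open>i < n\<close> are meaningful. Indices start at 0.
\<close>

subsection \<open>Functions\<close>

definition grad :: "(real ^ 'd \<Rightarrow> real) \<Rightarrow> real ^ 'd \<Rightarrow> real ^ 'd" where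
  "grad f x = (THE D. GDERIV f x :> D)"

definition F_class :: "real \<Rightarrow> real \<Rightarrow> (real ^ 'd \<Rightarrow> real) set" where
  "F_class m L = {f. (\<forall>x. f differentiable (at x)) \<and> continuous_on UNIV (grad f) \<and>
     (\<forall>x y. f y \<ge> f x + inner (grad f x) (y - x) + m / 2 * (norm (y - x))\<^sup>2) \<and>
     (\<forall>x y. norm (grad f x - grad f y) \<le> L * norm (x - y))}"

definition minimizer :: "(real ^ 'd \<Rightarrow> real) \<Rightarrow> real ^ 'd" where
  "minimizer f = (THE y. is_arg_min f (\<lambda>_. True) y)"

subsection \<open>Algorithms\<close>

definition algorithm_form :: "nat \<Rightarrow> real mat \<Rightarrow> real mat \<Rightarrow> real mat \<Rightarrow> bool" where
  "algorithm_form n A B C \<longleftrightarrow>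
     A \<in> carrier_mat n n \<and> B \<in> carrier_mat n 1 \<and> C \<in> carrier_mat 1 n \<and>
     (\<exists>v. eigenvector A v 1 \<and> C *\<^sub>v v \<noteq> 0\<^sub>v 1)"

definition out :: "real mat \<Rightarrow> (nat \<Rightarrow> real ^ 'd) \<Rightarrow> real ^ 'd" where
  "out C \<xi> = (\<Sum>j<dim_col C. C $$ (0, j) *\<^sub>R \<xi> j)"

fun state :: "real mat \<Rightarrow> real mat \<Rightarrow> real mat \<Rightarrow> (real ^ 'd \<Rightarrow> real) \<Rightarrow> (nat \<Rightarrow> real ^ 'd) \<Rightarrow>
    (nat \<Rightarrow> real ^ 'd) \<Rightarrow> nat \<Rightarrow> nat \<Rightarrow> real ^ 'd" where
  "state A B C f w \<xi>0 0 = \<xi>0"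
| "state A B C f w \<xi>0 (Suc t) = (\<lambda>i.
     (\<Sum>j<dim_col A. A $$ (i, j) *\<^sub>R state A B C f w \<xi>0 t j) +
     B $$ (i, 0) *\<^sub>R (grad f (out C (state A B C f w \<xi>0 t)) + w t))"

definition fixed_point :: "real mat \<Rightarrow> real mat \<Rightarrow> (real ^ 'd \<Rightarrow> real) \<Rightarrow> (nat \<Rightarrow> real ^ 'd) \<Rightarrow> bool" where
  "fixed_point A C f \<xi> \<longleftrightarrow>
     (\<forall>i<dim_row A. \<xi> i = (\<Sum>j<dim_col A. A $$ (i, j) *\<^sub>R \<xi> j)) \<and> minimizer f = out C \<xi>"

definition frob_dist :: "nat \<Rightarrow> (nat \<Rightarrow> real ^ 'd) \<Rightarrow> (nat \<Rightarrow> real ^ 'd) \<Rightarrow> real" where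
  "frob_dist n \<xi> \<zeta> = L2_set (\<lambda>i. norm (\<xi> i - \<zeta> i)) {..<n}"

text \<open>
  The argument \<open>\<xi>s\<close> gives the fixed point belonging to each function; it is only determined uniquely
  if the eigenspace of \<open>A\<close> at 1 is one-dimensional. If \<open>\<xi>0\<close> agrees with the fixed point, then so does
  every later state, and the quotient \<open>0 / 0 = 0\<close> does not contribute to the supremum.
  The infimum is taken in the extended reals, where \<open>Inf {} = \<infinity>\<close>.
\<close>

definition rate :: "real mat \<Rightarrow> real mat \<Rightarrow> real mat \<Rightarrow> ((real ^ 'd \<Rightarrow> real) \<Rightarrow> nat \<Rightarrow> real ^ 'd) \<Rightarrow>
    (real ^ 'd \<Rightarrow> real) set \<Rightarrow> ereal" where
  "rate A B C \<xi>s F = Inf {ereal r | r. r > 0 \<and>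
     (SUP f\<in>F. SUP \<xi>0. SUP t.
        ereal (frob_dist (dim_row A) (state A B C f (\<lambda>_. 0) \<xi>0 t) (\<xi>s f) /
               (r ^ t * frob_dist (dim_row A) \<xi>0 (\<xi>s f)))) < \<infinity>}"

text \<open>The joint distribution of the noise is a measure on the space of noise sequences.\<close>

definition noise_dists :: "real \<Rightarrow> (nat \<Rightarrow> real ^ 'd) measure set" where
  "noise_dists \<sigma> = {M. prob_space M \<and> sets M = sets (\<Pi>\<^sub>M t\<in>UNIV. borel) \<and>
     prob_space.indep_vars M (\<lambda>_. borel) (\<lambda>t w. w t) UNIV \<and>
     (\<forall>t. has_bochner_integral M (\<lambda>w. w t) 0) \<and>
     (\<forall>t. (\<integral>\<^sup>+ w. ennreal ((norm (w t))\<^sup>2) \<partial>M) \<le> ennreal (\<sigma>\<^sup>2))}"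

text \<open>
  For \<open>f\<close> in \<open>F_class m L\<close> the gradient is Lipschitz, so the integrand below is integrable for every
  admissible noise distribution.
\<close>

definition sens :: "real \<Rightarrow> real mat \<Rightarrow> real mat \<Rightarrow> real mat \<Rightarrow> (real ^ 'd \<Rightarrow> real) set \<Rightarrow> ereal" where
  "sens \<sigma> A B C F = (SUP f\<in>F. SUP \<xi>0. SUP M\<in>noise_dists \<sigma>.
     limsup (\<lambda>T. ereal (sqrt (\<integral>w. 1 / (\<sigma>\<^sup>2 * real T) *
       (\<Sum>t<T. (norm (out C (state A B C f w \<xi>0 t) - minimizer f))\<^sup>2) \<partial>M))))"

subsection \<open>Lifted matrices\<close>

definition append_cols :: "'a :: zero mat \<Rightarrow> 'a mat \<Rightarrow> 'a mat" (infixr \<open>@\<^sub>c\<close> 65) where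
  "X @\<^sub>c Y = four_block_mat X Y (0\<^sub>m 0 (dim_col X)) (0\<^sub>m 0 (dim_col Y))"

text \<open>
  \<open>evec l i\<close> is a column of height \<open>l + 1\<close>. The points \<open>1, \<dots>, l + 1\<close> are numbered \<open>0, \<dots>, l\<close> and
  the index \<open>\<star>\<close> is \<open>l + 1\<close>, where \<open>evec\<close> gives the zero column.
\<close>

definition evec :: "nat \<Rightarrow> nat \<Rightarrow> real mat" where
  "evec l i = mat (l + 1) 1 (\<lambda>(k, _). if k = i then 1 else 0)"

definition Zp :: "nat \<Rightarrow> real mat" where
  "Zp l = 1\<^sub>m l @\<^sub>c 0\<^sub>m l 1"

definition Z :: "nat \<Rightarrow> real mat" where
  "Z l = 0\<^sub>m l 1 @\<^sub>c 1\<^sub>m l"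

definition lift_A :: "nat \<Rightarrow> nat \<Rightarrow> real mat \<Rightarrow> real mat \<Rightarrow> real mat" where
  "lift_A n l A C =
     (A                        @\<^sub>c 0\<^sub>m n l           @\<^sub>c 0\<^sub>m n l) @\<^sub>r
     (Zp l * evec l 0 * C      @\<^sub>c Zp l * (Z l)\<^sup>T   @\<^sub>c 0\<^sub>m l l) @\<^sub>r
     (0\<^sub>m l n                  @\<^sub>c 0\<^sub>m l l           @\<^sub>c Zp l * (Z l)\<^sup>T)"

definition lift_B :: "nat \<Rightarrow> real mat \<Rightarrow> real mat" where
  "lift_B l B = B @\<^sub>r 0\<^sub>m l 1 @\<^sub>r Zp l * evec l 0"

definition lift_H :: "nat \<Rightarrow> real mat \<Rightarrow> real mat" where
  "lift_H l B = B @\<^sub>r 0\<^sub>m l 1 @\<^sub>r 0\<^sub>m l 1"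

definition lift_C :: "nat \<Rightarrow> nat \<Rightarrow> real mat \<Rightarrow> real mat" where
  "lift_C n l C =
     (evec l 0 * C    @\<^sub>c (Z l)\<^sup>T        @\<^sub>c 0\<^sub>m (l + 1) l) @\<^sub>r
     (0\<^sub>m (l + 1) n   @\<^sub>c 0\<^sub>m (l + 1) l   @\<^sub>c (Z l)\<^sup>T)"

definition lift_D :: "nat \<Rightarrow> real mat" where
  "lift_D l = 0\<^sub>m (l + 1) 1 @\<^sub>r evec l 0"

definition lift_X :: "nat \<Rightarrow> nat \<Rightarrow> real mat" where
  "lift_X n l = 1\<^sub>m n @\<^sub>c 0\<^sub>m n (2 * l + 1)"

definition lift_Y :: "nat \<Rightarrow> real mat \<Rightarrow> real mat" where
  "lift_Y l C = C @\<^sub>c 0\<^sub>m 1 (2 * l + 1)"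

text \<open>\<open>[A B; I 0]\<close>, \<open>[I 0]\<close> and \<open>[C D]\<close> for the lifted matrices\<close>

definition lift_AB :: "nat \<Rightarrow> nat \<Rightarrow> real mat \<Rightarrow> real mat \<Rightarrow> real mat \<Rightarrow> real mat" where
  "lift_AB n l A B C = four_block_mat (lift_A n l A C) (lift_B l B) (1\<^sub>m (n + 2 * l)) (0\<^sub>m (n + 2 * l) 1)"

definition lift_I0 :: "nat \<Rightarrow> nat \<Rightarrow> real mat" where
  "lift_I0 n l = 1\<^sub>m (n + 2 * l) @\<^sub>c 0\<^sub>m (n + 2 * l) 1"

definition lift_CD :: "nat \<Rightarrow> nat \<Rightarrow> real mat \<Rightarrow> real mat" where
  "lift_CD n l C = lift_C n l C @\<^sub>c lift_D l"

definition block_diag2 :: "real mat \<Rightarrow> real mat \<Rightarrow> real mat" where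
  "block_diag2 P Q = four_block_mat P (0\<^sub>m (dim_row P) (dim_col Q)) (0\<^sub>m (dim_row Q) (dim_col P)) Q"

subsection \<open>Multipliers\<close>

definition Pi_block :: "real \<Rightarrow> real \<Rightarrow> nat \<Rightarrow> nat \<Rightarrow> nat \<Rightarrow> real mat" where
  "Pi_block m L l i j =
     (let d = evec l i - evec l j; g = m \<cdot>\<^sub>m evec l i - L \<cdot>\<^sub>m evec l j
      in four_block_mat ((- m * L) \<cdot>\<^sub>m (d * d\<^sup>T)) (d * g\<^sup>T)
                        (g * d\<^sup>T)                  (- (d * d\<^sup>T)))"

text \<open>The sums are taken entrywise because \<open>mat\<close> and \<open>vec\<close> have no additive unit common to all sizes.\<close>

definition Pi_mult :: "real \<Rightarrow> real \<Rightarrow> nat \<Rightarrow> real mat \<Rightarrow> real mat" where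
  "Pi_mult m L l \<Lambda> = mat (2 * (l + 1)) (2 * (l + 1)) (\<lambda>(a, b).
     \<Sum>i<l + 2. \<Sum>j<l + 2. \<Lambda> $$ (i, j) * Pi_block m L l i j $$ (a, b))"

definition pi_mult :: "real \<Rightarrow> real \<Rightarrow> nat \<Rightarrow> real mat \<Rightarrow> real vec" where
  "pi_mult m L l \<Lambda> = vec (l + 1) (\<lambda>a.
     2 * (L - m) * (\<Sum>i<l + 2. \<Sum>j<l + 2. \<Lambda> $$ (i, j) * (evec l i - evec l j) $$ (a, 0)))"

definition neg_semidef :: "real mat \<Rightarrow> bool" where
  "neg_semidef M \<longleftrightarrow> M\<^sup>T = M \<and> (\<forall>v\<in>carrier_vec (dim_row M). v \<bullet> (M *\<^sub>v v) \<le> 0)"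

end

theory Submission
  imports Defs
begin

text \<open>
  The gradients and values of a function in \<open>F_class m L\<close> at any finite set of points satisfy the
  interpolation inequalities; these say that \<open>\<Pi>(\<Lambda>)\<close> and \<open>\<pi>(\<Lambda>)\<close>, evaluated on
  the last \<open>l + 1\<close> iterates and the minimizer, have a nonnegative sum. Hence the storage
  \<open>V\<close>, the quadratic form of \<open>P\<close> in the lifted state plus the \<open>p\<close>-combination of the last \<open>l\<close>
  function gaps, satisfies \<open>V (t + 1) \<le> r\<^sup>2 * V t\<close> and dominates the squared distance to the fixed point.
  Pretending that the iterates before time 0 were at the minimizer makes this true from \<open>t = 0\<close> on,
  so no estimate of a start-up phase is needed. With noise, \<open>V (t + 1)\<close> additionally contains
  a term linear in \<open>w t\<close>, whose mean vanishes because \<open>w t\<close> is independent of the past, and \<open>H\<^sup>T P H\<close> times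
  the squared norm of \<open>w t\<close>. Averaging over time gives the bound on the sensitivity.
\<close>

subsection \<open>Strongly convex functions with Lipschitz gradient\<close>

text \<open>The matrix inequalities speak about real vectors of length \<open>n + 2 * l + 1\<close>,
  whereas every row of the state is a point of \<open>real ^ 'd\<close>, and the gradient mixes the
  coordinates of that point. They are therefore applied to each coordinate separately and summed,
  which turns products into inner products; only then does the interpolation inequality, which
  couples all coordinates, come in. The current output is no separate unknown: it is
  \<open>C\<close> times the state. So the lifted state and the current gradient together determine
  all \<open>l + 1\<close> points and gradients. Placing the missing past at the minimizer is
  harmless because interpolation asks for no trajectory: it holds for arbitrary points of one
  function, repeated ones included. The minimizer has zero gradient and zero gap, so the initial
  storage is a form in the initial error alone. Noise at time \<open>t\<close> moves only the next
  state, not the remembered outputs and gradients. This is why \<open>lift_H\<close> rather than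
  \<open>lift_B\<close> measures its effect, and why the factor of \<open>w t\<close> in the cross
  term depends on earlier noise only.\<close>

lemma GDERIV_grad:
  fixes f :: "real ^ 'd \<Rightarrow> real"
  assumes "f differentiable (at x)"
  shows "GDERIV f x :> grad f x"
proof -
  obtain f' where f': "(f has_derivative f') (at x)"
    using assms unfolding differentiable_def by blast
  have lin: "linear f'" using f' by (rule has_derivative_linear)
  \<comment> \<open>The Riesz representative of the derivative. As \<open>grad\<close> is a definite
    description, uniqueness has to be shown too.\<close>
  define D where "D = (\<Sum>b\<in>Basis. f' b *\<^sub>R b)"
  have "f' h = inner h D" for h
  proof -
    have "f' h = f' (\<Sum>b\<in>Basis. inner h b *\<^sub>R b)" by (simp add: euclidean_representation)
    also have "\<dots> = (\<Sum>b\<in>Basis. inner h b * f' b)"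
      using lin by (simp add: linear_sum linear_cmul)
    also have "\<dots> = inner h D" unfolding D_def by (simp add: inner_sum_right mult.commute)
    finally show ?thesis .
  qed
  then have "f' = (\<lambda>h. inner h D)" by blast
  with f' have D: "GDERIV f x :> D" by (simp add: gderiv_def)
  have "E = D" if "GDERIV f x :> E" for E
  proof -
    have "(\<lambda>h. inner h E) = (\<lambda>h. inner h D)"
      using that D unfolding gderiv_def by (rule has_derivative_unique)
    then have "inner (E - D) (E - D) = 0"
      by (metis inner_diff_right cancel_comm_monoid_add_class.diff_cancel)
    then show ?thesis by simp
  qed
  then have "(THE D. GDERIV f x :> D) = D" using D by (intro the_equality)
  then show ?thesis using D by (simp add: grad_def)
qed

lemma grad_eqI:
  fixes f :: "real ^ 'd \<Rightarrow> real"
  assumes "GDERIV f x :> D"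
  shows "grad f x = D"
proof -
  have "f differentiable (at x)" using assms unfolding gderiv_def differentiable_def by blast
  then have "GDERIV f x :> grad f x" by (rule GDERIV_grad)
  then have "(\<lambda>h. inner h (grad f x)) = (\<lambda>h. inner h D)"
    using assms unfolding gderiv_def by (rule has_derivative_unique)
  then have "inner (grad f x - D) (grad f x - D) = 0"
    by (metis inner_diff_right cancel_comm_monoid_add_class.diff_cancel)
  then show ?thesis by simp
qed

text \<open>Along the segment from \<open>x\<close> to \<open>y\<close>, let \<open>\<phi>\<close>
  be \<open>f\<close> minus the claimed bound up to a constant. By Cauchy-Schwarz and the Lipschitz
  condition its derivative is nonpositive for nonnegative arguments, so
  \<open>\<phi> 1 \<le> \<phi> 0\<close>.\<close>

lemma F_class_descent:
  fixes f :: "real ^ 'd \<Rightarrow> real"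
  assumes f: "f \<in> F_class m L"
  shows "f y \<le> f x + inner (grad f x) (y - x) + L / 2 * (norm (y - x))\<^sup>2"
proof -
  define d where "d = y - x"
  define \<phi> where "\<phi> t = f (x + t *\<^sub>R d) - t * inner (grad f x) d - L / 2 * t\<^sup>2 * (norm d)\<^sup>2" for t
  define \<phi>' where "\<phi>' t = inner (grad f (x + t *\<^sub>R d) - grad f x) d - L * t * (norm d)\<^sup>2" for t
  have "(\<phi> has_real_derivative \<phi>' t) (at t)" for t
  proof -
    have "f differentiable (at (x + t *\<^sub>R d))" using f by (simp add: F_class_def)
    then have "(f has_derivative (\<lambda>h. inner h (grad f (x + t *\<^sub>R d)))) (at (x + t *\<^sub>R d))"
      using GDERIV_grad unfolding gderiv_def by blast
    moreover have "((\<lambda>t. x + t *\<^sub>R d) has_derivative (\<lambda>h. h *\<^sub>R d)) (at t)"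
      by (auto intro!: derivative_eq_intros)
    ultimately have "((\<lambda>t. f (x + t *\<^sub>R d)) has_derivative
        (\<lambda>h. inner (h *\<^sub>R d) (grad f (x + t *\<^sub>R d)))) (at t)"
      by (rule has_derivative_compose[rotated])
    then have "((\<lambda>t. f (x + t *\<^sub>R d)) has_real_derivative inner (grad f (x + t *\<^sub>R d)) d) (at t)"
      by (simp add: has_field_derivative_def inner_commute mult_commute_abs)
    then show ?thesis unfolding \<phi>_def \<phi>'_def
      by (auto intro!: derivative_eq_intros simp: inner_diff_left)
  qed
  moreover have "\<phi>' t \<le> 0" if "0 \<le> t" for t
  proof -
    have "inner (grad f (x + t *\<^sub>R d) - grad f x) d \<le> norm (grad f (x + t *\<^sub>R d) - grad f x) * norm d"
      by (rule norm_cauchy_schwarz)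
    also have "\<dots> \<le> (L * norm (x + t *\<^sub>R d - x)) * norm d"
      using f unfolding F_class_def by (intro mult_right_mono norm_ge_zero) blast
    also have "\<dots> = L * t * (norm d)\<^sup>2" using that by (simp add: power2_eq_square)
    finally show ?thesis by (simp add: \<phi>'_def)
  qed
  ultimately have "\<phi> 1 \<le> \<phi> 0"
    by (intro DERIV_nonpos_imp_nonincreasing[of 0 1 \<phi>]) auto
  then show ?thesis by (simp add: \<phi>_def d_def)
qed

lemma F_class_lower:
  "f \<in> F_class m L \<Longrightarrow> f x + inner (grad f x) (y - x) + m / 2 * (norm (y - x))\<^sup>2 \<le> f y"
  by (simp add: F_class_def)

lemma F_class_lipschitz:
  "f \<in> F_class m L \<Longrightarrow> norm (grad f x - grad f y) \<le> L * norm (x - y)"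
  by (simp add: F_class_def)

text \<open>Strong convexity makes \<open>f\<close> coercive, so a minimum over a compact ball is
  global. A gradient step from it cannot decrease \<open>f\<close>, hence the gradient vanishes
  there, and strong convexity around that point excludes any other minimizer.\<close>

lemma F_class_minimizer:
  fixes f :: "real ^ 'd \<Rightarrow> real"
  assumes f: "f \<in> F_class m L" and m: "0 < m" "m \<le> L"
  shows F_class_grad_minimizer: "grad f (minimizer f) = 0"
    and F_class_minimizer_le: "f (minimizer f) \<le> f y"
proof -
  define g where "g = grad f 0"
  \<comment> \<open>Beyond this radius the quadratic term \<open>m / 2 * (norm y)\<^sup>2\<close>
    outweighs the linear term \<open>inner g y\<close>.\<close>
  define R where "R = 2 * norm g / m"
  have R: "R \<ge> 0" using m by (simp add: R_def)
  have "continuous_on (cball 0 R) f"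
    using f unfolding F_class_def
    by (auto intro!: continuous_at_imp_continuous_on differentiable_imp_continuous_within)
  then obtain z where z: "z \<in> cball 0 R" "\<And>y. y \<in> cball 0 R \<Longrightarrow> f z \<le> f y"
    using continuous_attains_inf[of "cball (0 :: real ^ 'd) R" f] R by force
  have z_le: "f z \<le> f y" for y
  proof (cases "y \<in> cball 0 R")
    case False
    then have y: "norm y > R" by simp
    then have "norm g \<le> m / 2 * norm y" using m by (simp add: R_def field_simps)
    then have "norm g * norm y \<le> m / 2 * norm y * norm y" by (rule mult_right_mono) simp
    moreover have "- (norm g * norm y) \<le> inner g y"
      using norm_cauchy_schwarz[of "- g" y] by simp
    moreover have "f 0 + inner g y + m / 2 * (norm y)\<^sup>2 \<le> f y"
      using F_class_lower[OF f, of 0 y] by (simp add: g_def)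
    ultimately have "f 0 \<le> f y" by (simp add: power2_eq_square)
    then show ?thesis using z(2)[of 0] R by simp
  qed (use z in blast)
  have gz: "grad f z = 0"
  proof -
    \<comment> \<open>The step length that minimizes the upper bound of
      \<open>F_class_descent\<close> along the negative gradient.\<close>
    define s where "s = 1 / L"
    have "f z \<le> f (z - s *\<^sub>R grad f z)" by (rule z_le)
    also have "\<dots> \<le> f z + inner (grad f z) (- (s *\<^sub>R grad f z)) + L / 2 * (norm (s *\<^sub>R grad f z))\<^sup>2"
      using F_class_descent[OF f, of "z - s *\<^sub>R grad f z" z] by simp
    also have "\<dots> = f z - (norm (grad f z))\<^sup>2 / (2 * L)"
      using m by (simp add: s_def power_mult_distrib power2_norm_eq_inner field_simps)
        (simp add: power2_eq_square field_simps)
    finally have "(norm (grad f z))\<^sup>2 / (2 * L) \<le> 0" by simp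
    then have "(norm (grad f z))\<^sup>2 \<le> 0" using m by (simp add: divide_le_0_iff)
    then show ?thesis by simp
  qed
  have "minimizer f = z"
    unfolding minimizer_def
  proof (rule the_equality)
    show "is_arg_min f (\<lambda>_. True) z" using z_le by (simp add: is_arg_min_linorder)
    fix y assume "is_arg_min f (\<lambda>_. True) y"
    then have "f y \<le> f z" by (simp add: is_arg_min_linorder)
    moreover have "f z + m / 2 * (norm (y - z))\<^sup>2 \<le> f y" using F_class_lower[OF f, of z y] gz by simp
    ultimately have "m / 2 * (norm (y - z))\<^sup>2 \<le> 0" by simp
    then have "(norm (y - z))\<^sup>2 \<le> 0" using m by (simp add: mult_le_0_iff)
    then show "y = z" by simp
  qed
  then show "grad f (minimizer f) = 0" "f (minimizer f) \<le> f y" using gz z_le by auto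
qed

text \<open>Subtracting \<open>m / 2\<close> times the squared norm from \<open>f\<close> leaves a
  convex function with modulus of smoothness \<open>L - m\<close>, and \<open>h\<close> is the
  difference of its gradients. Comparing the lower bound from \<open>y\<close> with the upper bound
  from \<open>x\<close> at a common point \<open>z\<close> gives the inequality. It is kept
  multiplied by \<open>2 * (L - m)\<close>, so that it also covers \<open>L = m\<close>.\<close>

lemma F_class_interpolation:
  fixes f :: "real ^ 'd \<Rightarrow> real"
  assumes f: "f \<in> F_class m L" and m: "0 < m" "m \<le> L"
  shows "0 \<le> 2 * (L - m) * (f x - f y) - m * L * (norm (x - y))\<^sup>2
      + 2 * inner (x - y) (m *\<^sub>R grad f x - L *\<^sub>R grad f y) - (norm (grad f x - grad f y))\<^sup>2"
proof -
  define d where "d = x - y"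
  define k where "k = grad f x - grad f y"
  define h where "h = k - m *\<^sub>R d"
  have conv: "0 \<le> f x - f y - inner (grad f y) d - m / 2 * inner d d
      - s * inner h h + (L - m) / 2 * s\<^sup>2 * inner h h" for s
  proof -
    define z where "z = x - s *\<^sub>R h"
    have 1: "f y + inner (grad f y) (z - y) + m / 2 * (norm (z - y))\<^sup>2 \<le> f z"
      by (rule F_class_lower[OF f])
    have 2: "f z \<le> f x + inner (grad f x) (z - x) + L / 2 * (norm (z - x))\<^sup>2"
      by (rule F_class_descent[OF f])
    have zy: "z - y = d - s *\<^sub>R h" and zx: "z - x = - s *\<^sub>R h" by (auto simp: z_def d_def)
    have gx: "grad f x = grad f y + h + m *\<^sub>R d" by (simp add: h_def k_def)
    have "f y + inner (grad f y) d - s * inner (grad f y) h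
        + m / 2 * (inner d d - 2 * s * inner d h + s\<^sup>2 * inner h h)
      \<le> f x - s * (inner (grad f y) h + inner h h + m * inner d h) + L / 2 * (s\<^sup>2 * inner h h)"
      using order.trans[OF 1 2] unfolding zy zx gx power2_norm_eq_inner
      by (simp add: inner_diff_left inner_diff_right inner_add_left inner_add_right
          inner_commute[of h d] power2_eq_square algebra_simps)
    then show ?thesis by (simp add: algebra_simps add_divide_distrib diff_divide_distrib)
  qed
  have hh: "inner h h = inner k k - 2 * m * inner d k + m\<^sup>2 * inner d d"
    by (simp add: h_def inner_diff_left inner_diff_right inner_commute[of k d] power2_eq_square algebra_simps)
  \<comment> \<open>Completing the square: it remains to bound \<open>inner h h\<close> by the part
    of \<open>conv\<close> that is free of \<open>s\<close>, scaled by
    \<open>2 * (L - m)\<close>.\<close>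
  have goal: "2 * (L - m) * (f x - f y) - m * L * (norm (x - y))\<^sup>2
      + 2 * inner (x - y) (m *\<^sub>R grad f x - L *\<^sub>R grad f y) - (norm (grad f x - grad f y))\<^sup>2
     = 2 * (L - m) * (f x - f y - inner (grad f y) d - m / 2 * inner d d) - inner h h"
  proof -
    have "m *\<^sub>R grad f x - L *\<^sub>R grad f y = m *\<^sub>R k - (L - m) *\<^sub>R grad f y"
      by (simp add: k_def algebra_simps)
    then show ?thesis unfolding hh d_def[symmetric] k_def[symmetric] power2_norm_eq_inner
      by (simp add: inner_diff_right inner_commute[of "grad f y" d] power2_eq_square algebra_simps)
  qed
  show ?thesis
  proof (cases "L = m")
    case True
    \<comment> \<open>No choice of \<open>s\<close> is optimal here. Instead strong monotonicity
      with modulus \<open>m\<close> and the Lipschitz constant \<open>L = m\<close> force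
      \<open>h\<close> to vanish.\<close>
    have "inner d k \<ge> m * inner d d"
      using F_class_lower[OF f, of x y] F_class_lower[OF f, of y x]
      unfolding d_def k_def power2_norm_eq_inner
      by (simp add: inner_diff_left inner_diff_right inner_commute algebra_simps)
    then have "m * (m * inner d d) \<le> m * inner d k"
      using m by (intro mult_left_mono) auto
    moreover have "inner k k \<le> m\<^sup>2 * inner d d"
    proof -
      have "(norm k)\<^sup>2 \<le> (L * norm d)\<^sup>2"
        unfolding d_def k_def by (intro power_mono F_class_lipschitz[OF f]) simp
      then show ?thesis using True by (simp add: power_mult_distrib power2_norm_eq_inner)
    qed
    ultimately have "inner h h \<le> 0" unfolding hh by (simp add: power2_eq_square)
    then show ?thesis unfolding goal using True by simp
  next
    case False
    then have M: "L - m > 0" using m by simp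
    \<comment> \<open>Minimizes the right-hand side of \<open>conv\<close> over
      \<open>s\<close>.\<close>
    define s where "s = 1 / (L - m)"
    have "0 \<le> 2 * (L - m) * (f x - f y - inner (grad f y) d - m / 2 * inner d d
      - s * inner h h + (L - m) / 2 * s\<^sup>2 * inner h h)"
      using conv[of s] M by (intro mult_nonneg_nonneg) auto
    also have "\<dots> = 2 * (L - m) * (f x - f y - inner (grad f y) d - m / 2 * inner d d)
        - 2 * ((L - m) * s) * inner h h + ((L - m) * s)\<^sup>2 * inner h h"
      by (simp add: power2_eq_square field_simps)
    also have "(L - m) * s = 1" using M by (simp add: s_def)
    finally show ?thesis unfolding goal by simp
  qed
qed

text \<open>A concrete member of the class: strong convexity holds with equality. In dimension one
  it later shows that the value under the root in the sensitivity bound is nonnegative.\<close>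

lemma quadratic_in_F_class:
  fixes f :: "real ^ 'd \<Rightarrow> real"
  assumes m: "0 < m" "m \<le> L"
  defines "f \<equiv> \<lambda>x. m / 2 * inner x x"
  shows "f \<in> F_class m L" and "grad f x = m *\<^sub>R x" and "minimizer f = 0"
proof -
  have G: "GDERIV f x :> m *\<^sub>R x" for x
    unfolding f_def gderiv_def
    by (auto intro!: derivative_eq_intros simp: inner_commute algebra_simps)
  then show grad: "grad f x = m *\<^sub>R x" for x by (rule grad_eqI)
  then have grad': "grad f = (\<lambda>x. m *\<^sub>R x)" by blast
  have "f differentiable (at x)" for x
    using G unfolding gderiv_def differentiable_def by blast
  moreover have "f x + inner (m *\<^sub>R x) (y - x) + m / 2 * (norm (y - x))\<^sup>2 = f y" for x y
    unfolding f_def power2_norm_eq_inner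
    by (simp add: inner_diff_left inner_diff_right inner_commute[of y x] algebra_simps)
  moreover have "norm (m *\<^sub>R x - m *\<^sub>R y) \<le> L * norm (x - y)" for x y :: "real ^ 'd"
    using m by (auto simp flip: scaleR_diff_right intro!: mult_right_mono)
  moreover have "continuous_on UNIV (\<lambda>x :: real ^ 'd. m *\<^sub>R x)" by (intro continuous_intros)
  ultimately show f: "f \<in> F_class m L" by (auto simp: F_class_def grad')
  show "minimizer f = 0" using F_class_grad_minimizer[OF f m] m by (simp add: grad)
qed

subsection \<open>Quadratic forms of the lifted matrices\<close>

text \<open>For real entries this is the quadratic form of \<open>M\<close>; for entries in
  \<open>real ^ 'd\<close> it is the trace of that form over the coordinates. The common type lets
  the same expression be used before and after summing over coordinates.\<close>

definition gram_form :: "real mat \<Rightarrow> nat \<Rightarrow> (nat \<Rightarrow> 'a::real_inner) \<Rightarrow> real" where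
  "gram_form M N x = (\<Sum>i<N. \<Sum>j<N. M $$ (i, j) * inner (x i) (x j))"

definition stack :: "nat \<Rightarrow> nat \<Rightarrow> (nat \<Rightarrow> 'a) \<Rightarrow> (nat \<Rightarrow> 'a) \<Rightarrow> (nat \<Rightarrow> 'a) \<Rightarrow> nat \<Rightarrow> 'a" where
  "stack n l x a b i = (if i < n then x i else if i < n + l then a (i - n) else b (i - n - l))"

text \<open>
  In \<open>y\<close> and \<open>u\<close> the index 0 is the current time, \<open>k\<close> is \<open>k\<close> steps earlier, and \<open>l + 1\<close> is the
  index \<open>\<star>\<close>, where both vanish after shifting the minimizer to the origin.
\<close>

definition pair_form :: "real \<Rightarrow> real \<Rightarrow> (nat \<Rightarrow> 'a::real_inner) \<Rightarrow> (nat \<Rightarrow> 'a) \<Rightarrow> nat \<Rightarrow> nat \<Rightarrow> real" where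
  "pair_form m L y u i j = - (m * L) * (norm (y i - y j))\<^sup>2
     + 2 * inner (y i - y j) (m *\<^sub>R u i - L *\<^sub>R u j) - (norm (u i - u j))\<^sup>2"

definition multiplier_form :: "real \<Rightarrow> real \<Rightarrow> nat \<Rightarrow> real mat \<Rightarrow> (nat \<Rightarrow> 'a::real_inner) \<Rightarrow> (nat \<Rightarrow> 'a) \<Rightarrow> real" where
  "multiplier_form m L l \<Lambda> y u = (\<Sum>i<l + 2. \<Sum>j<l + 2. \<Lambda> $$ (i, j) * pair_form m L y u i j)"

lemma vec_stack:
  "vec (n + 2 * l) (stack n l x a b) = vec n x @\<^sub>v vec l a @\<^sub>v vec l b"
  by (rule eq_vecI) (auto simp: stack_def)

lemma scalar_prod_mat_vec:
  assumes "M \<in> carrier_mat N N"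
  shows "vec N x \<bullet> (M *\<^sub>v vec N x) = gram_form M N x"
proof -
  have "vec N x \<bullet> (M *\<^sub>v vec N x) = (\<Sum>i<N. x i * (row M i \<bullet> vec N x))"
    using assms by (simp add: scalar_prod_def[of "vec N x"] lessThan_atLeast0)
  also have "\<dots> = gram_form M N x"
    unfolding gram_form_def using assms
    by (auto intro!: sum.cong simp: scalar_prod_def sum_distrib_left lessThan_atLeast0)
  finally show ?thesis .
qed

lemma quadratic_congruence:
  fixes M :: "real mat"
  assumes M: "M \<in> carrier_mat k k" and G: "G \<in> carrier_mat k N" and v: "v \<in> carrier_vec N"
  shows "v \<bullet> ((G\<^sup>T * M * G) *\<^sub>v v) = (G *\<^sub>v v) \<bullet> (M *\<^sub>v (G *\<^sub>v v))"
proof -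
  let ?w = "M *\<^sub>v (G *\<^sub>v v)"
  have w: "?w \<in> carrier_vec k" using M G v by auto
  have "(G\<^sup>T * M * G) *\<^sub>v v = G\<^sup>T *\<^sub>v ?w"
    using M G v by (simp add: assoc_mult_mat_vec[of "G\<^sup>T" N k "M * G" N] assoc_mult_mat_vec[of M k k G N])
  then have "v \<bullet> ((G\<^sup>T * M * G) *\<^sub>v v) = (G\<^sup>T *\<^sub>v ?w) \<bullet> v"
    using comm_scalar_prod[OF v, of "G\<^sup>T *\<^sub>v ?w"] G w
    by (simp only: mult_mat_vec_carrier[OF transpose_carrier_mat[THEN iffD2, OF G]])
  also have "\<dots> = ?w \<bullet> (G *\<^sub>v v)" by (rule transpose_vec_mult_scalar[OF G v w])
  also have "\<dots> = (G *\<^sub>v v) \<bullet> ?w" using w G v by (intro comm_scalar_prod[of _ k]) auto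
  finally show ?thesis .
qed

section \<open>Block matrices and shift matrices acting on vectors\<close>

lemma append_cols_carrier [simp, intro]:
  "X \<in> carrier_mat k a \<Longrightarrow> Y \<in> carrier_mat k b \<Longrightarrow> X @\<^sub>c Y \<in> carrier_mat k (a + b)"
  unfolding append_cols_def carrier_mat_def by simp

lemma append_cols_mult_vec:
  assumes "(X :: real mat) \<in> carrier_mat k a" "Y \<in> carrier_mat k b" "v \<in> carrier_vec a" "w \<in> carrier_vec b"
  shows "(X @\<^sub>c Y) *\<^sub>v (v @\<^sub>v w) = X *\<^sub>v v + Y *\<^sub>v w"
proof -
  have "(X @\<^sub>c Y) *\<^sub>v (v @\<^sub>v w)
      = (X *\<^sub>v v + Y *\<^sub>v w) @\<^sub>v (0\<^sub>m 0 a *\<^sub>v v + 0\<^sub>m 0 b *\<^sub>v w)"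
    using assms unfolding append_cols_def by (subst four_block_mat_mult_vec[of _ k a _ b _ 0]) auto
  also have "\<dots> = X *\<^sub>v v + Y *\<^sub>v w" using assms by (intro eq_vecI) auto
  finally show ?thesis .
qed

lemma append_cols3_carrier:
  "X \<in> carrier_mat k a \<Longrightarrow> Y \<in> carrier_mat k b \<Longrightarrow> W \<in> carrier_mat k c \<Longrightarrow>
    X @\<^sub>c Y @\<^sub>c W \<in> carrier_mat k (a + (b + c))"
  by simp

lemma append_cols3_mult_vec:
  assumes X: "(X :: real mat) \<in> carrier_mat k a" and Y: "Y \<in> carrier_mat k b" and W: "W \<in> carrier_mat k c"
    and u: "u \<in> carrier_vec a" and v: "v \<in> carrier_vec b" and w: "w \<in> carrier_vec c"
  shows "(X @\<^sub>c Y @\<^sub>c W) *\<^sub>v (u @\<^sub>v v @\<^sub>v w) = X *\<^sub>v u + (Y *\<^sub>v v + W *\<^sub>v w)"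
  using append_cols_mult_vec[OF X append_cols_carrier[OF Y W] u append_carrier_vec[OF v w]]
    append_cols_mult_vec[OF Y W v w] by simp

lemma append_rows3_carrier:
  assumes "(X :: real mat) \<in> carrier_mat a k" "Y \<in> carrier_mat b k" "W \<in> carrier_mat c k"
  shows "X @\<^sub>r Y @\<^sub>r W \<in> carrier_mat (a + (b + c)) k"
  using assms by (intro carrier_append_rows)

lemma append_rows3_mult_vec:
  assumes X: "(X :: real mat) \<in> carrier_mat a k" and Y: "Y \<in> carrier_mat b k" and W: "W \<in> carrier_mat c k"
    and v: "v \<in> carrier_vec k"
  shows "(X @\<^sub>r Y @\<^sub>r W) *\<^sub>v v = X *\<^sub>v v @\<^sub>v Y *\<^sub>v v @\<^sub>v W *\<^sub>v v"
  using mat_mult_append[OF X carrier_append_rows[OF Y W] v] mat_mult_append[OF Y W v] by simp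

lemma evec_carrier [simp, intro]: "evec l i \<in> carrier_mat (l + 1) 1"
  by (simp add: evec_def)

lemma Zp_carrier [simp, intro]: "Zp l \<in> carrier_mat l (l + 1)"
  and Z_carrier [simp, intro]: "Z l \<in> carrier_mat l (l + 1)"
  using append_cols_carrier[of "1\<^sub>m l" l l "0\<^sub>m l 1" 1] append_cols_carrier[of "0\<^sub>m l 1" l 1 "1\<^sub>m l" l]
  by (simp_all add: Zp_def Z_def)

lemma Zp_index: "i < l \<Longrightarrow> j < l + 1 \<Longrightarrow> Zp l $$ (i, j) = (if i = j then 1 else 0)"
  by (auto simp: Zp_def append_cols_def)

lemma Z_index: "i < l \<Longrightarrow> j < l + 1 \<Longrightarrow> Z l $$ (i, j) = (if j = Suc i then 1 else 0)"
  by (auto simp: Z_def append_cols_def)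

lemma Zp_mult_vec:
  assumes "v \<in> carrier_vec (l + 1)"
  shows "Zp l *\<^sub>v v = vec l (\<lambda>k. v $ k)"
proof (rule eq_vecI)
  fix k assume k: "k < dim_vec (vec l (\<lambda>k. v $ k))"
  then have "row (Zp l) k = unit_vec (l + 1) k"
    by (intro eq_vecI) (auto simp: Zp_index unit_vec_def carrier_matD[OF Zp_carrier])
  then show "(Zp l *\<^sub>v v) $ k = vec l (\<lambda>k. v $ k) $ k"
    using k assms by (simp add: carrier_matD[OF Zp_carrier] scalar_prod_left_unit[of v "l + 1"])
qed (simp add: carrier_matD[OF Zp_carrier])

lemma Z_transpose_mult_vec:
  "(Z l)\<^sup>T *\<^sub>v vec l a = vec (l + 1) (\<lambda>k. if k = 0 then 0 else a (k - 1))"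
proof (rule eq_vecI)
  fix k assume k: "k < dim_vec (vec (l + 1) (\<lambda>k. if k = 0 then 0 else a (k - 1)))"
  show "((Z l)\<^sup>T *\<^sub>v vec l a) $ k = vec (l + 1) (\<lambda>k. if k = 0 then 0 else a (k - 1)) $ k"
  proof (cases k)
    case 0
    then have "col (Z l) k = 0\<^sub>v l"
      by (intro eq_vecI) (auto simp: Z_index carrier_matD[OF Z_carrier])
    then show ?thesis using 0 by (simp add: carrier_matD[OF Z_carrier])
  next
    case (Suc i)
    then have "col (Z l) k = unit_vec l i"
      using k by (intro eq_vecI) (auto simp: Z_index unit_vec_def carrier_matD[OF Z_carrier])
    then show ?thesis using Suc k
      by (simp add: carrier_matD[OF Z_carrier] scalar_prod_left_unit[of "vec l a" l])
  qed
qed (simp add: carrier_matD[OF Z_carrier])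

lemma evec_mult_vec:
  assumes "v \<in> carrier_vec 1"
  shows "evec l 0 *\<^sub>v v = vec (l + 1) (\<lambda>k. if k = 0 then v $ 0 else 0)"
  using assms by (intro eq_vecI) (auto simp: evec_def scalar_prod_def)

lemma dim_lift [simp]: "dim_row (Zp l) = l" "dim_col (Zp l) = l + 1"
    "dim_row (Z l) = l" "dim_col (Z l) = l + 1" "dim_row (evec l i) = l + 1" "dim_col (evec l i) = 1"
  using carrier_matD[OF Zp_carrier] carrier_matD[OF Z_carrier] carrier_matD[OF evec_carrier] by auto

lemma lift_C_carrier [simp, intro]:
  assumes C: "C \<in> carrier_mat 1 n"
  shows "lift_C n l C \<in> carrier_mat (2 * (l + 1)) (n + 2 * l)"
proof -
  have "lift_C n l C \<in> carrier_mat ((l + 1) + (l + 1)) (n + (l + l))"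
    unfolding lift_C_def using C
    by (intro carrier_append_rows append_cols_carrier) auto
  then show ?thesis by (simp add: mult_2)
qed

lemma lift_D_carrier [simp, intro]: "lift_D l \<in> carrier_mat (2 * (l + 1)) 1"
proof -
  have "lift_D l \<in> carrier_mat ((l + 1) + (l + 1)) 1"
    unfolding lift_D_def by (intro carrier_append_rows) auto
  then show ?thesis by (simp add: mult_2)
qed

lemma lift_A_carrier [simp, intro]:
  assumes A: "A \<in> carrier_mat n n" and C: "C \<in> carrier_mat 1 n"
  shows "lift_A n l A C \<in> carrier_mat (n + 2 * l) (n + 2 * l)"
proof -
  have "lift_A n l A C \<in> carrier_mat (n + (l + l)) (n + (l + l))"
    unfolding lift_A_def using A C
    by (intro carrier_append_rows append_cols_carrier) auto
  then show ?thesis by (simp add: mult_2)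
qed

lemma lift_B_carrier [simp, intro]:
  assumes B: "B \<in> carrier_mat n 1"
  shows "lift_B l B \<in> carrier_mat (n + 2 * l) 1"
proof -
  have "lift_B l B \<in> carrier_mat (n + (l + l)) 1"
    unfolding lift_B_def using B by (intro carrier_append_rows) auto
  then show ?thesis by (simp add: mult_2)
qed

section \<open>The lifted matrices applied to a state, its past and the current gradient\<close>

context
  fixes n l :: nat and C :: "real mat" and x y u :: "nat \<Rightarrow> real"
  assumes C: "C \<in> carrier_mat 1 n"
    and y0: "y 0 = (\<Sum>j<n. C $$ (0, j) * x j)"
begin

abbreviation (input) "past_u \<equiv> vec l (\<lambda>k. u (Suc k))"
abbreviation (input) "past_y \<equiv> vec l (\<lambda>k. y (Suc k))"
abbreviation (input) "stacked \<equiv> vec n x @\<^sub>v past_y @\<^sub>v past_u"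

lemma output_mult_vec: "C *\<^sub>v vec n x = vec 1 (\<lambda>_. y 0)"
  using C y0 by (intro eq_vecI) (auto simp: scalar_prod_def lessThan_atLeast0)

text \<open>The transpose of \<open>Z\<close> moves the past back by one place and leaves entry 0
  free; the first unit vector times the current output fills it.\<close>

lemma newest_y: "(evec l 0 * C) *\<^sub>v vec n x + (Z l)\<^sup>T *\<^sub>v past_y = vec (l + 1) y"
proof -
  have "(evec l 0 * C) *\<^sub>v vec n x = evec l 0 *\<^sub>v (C *\<^sub>v vec n x)"
    using C by (intro assoc_mult_mat_vec) auto
  then show ?thesis
    by (auto simp: output_mult_vec evec_mult_vec Z_transpose_mult_vec)
qed

lemma newest_u: "(Z l)\<^sup>T *\<^sub>v past_u + evec l 0 *\<^sub>v vec 1 (\<lambda>_. u 0) = vec (l + 1) u"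
  by (auto simp: evec_mult_vec Z_transpose_mult_vec)

lemma stacked_carrier: "stacked \<in> carrier_vec (n + (l + l))"
  by (intro append_carrier_vec) auto

text \<open>Recovers all \<open>l + 1\<close> outputs and gradients: the current output is computed
  from the state, the current gradient is the appended input.\<close>

lemma lift_CD_mult_vec:
  "lift_CD n l C *\<^sub>v (stacked @\<^sub>v vec 1 (\<lambda>_. u 0)) = vec (l + 1) y @\<^sub>v vec (l + 1) u"
proof -
  let ?u = "vec 1 (\<lambda>_. u 0)"
  have eC: "evec l 0 * C \<in> carrier_mat (l + 1) n" using C by auto
  have zT: "(Z l)\<^sup>T \<in> carrier_mat (l + 1) l" by auto
  have v[simp]: "vec n x \<in> carrier_vec n" "past_y \<in> carrier_vec l" "past_u \<in> carrier_vec l" by auto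
  note c1 = append_cols3_carrier[OF eC zT zero_carrier_mat[of "l + 1" l]]
  note c2 = append_cols3_carrier[OF zero_carrier_mat[of "l + 1" n] zero_carrier_mat[of "l + 1" l] zT]
  have z1: "0\<^sub>m (l + 1) l *\<^sub>v past_u = 0\<^sub>v (l + 1)" "0\<^sub>m (l + 1) l *\<^sub>v past_y = 0\<^sub>v (l + 1)"
    "0\<^sub>m (l + 1) n *\<^sub>v vec n x = 0\<^sub>v (l + 1)" "0\<^sub>m (l + 1) 1 *\<^sub>v ?u = 0\<^sub>v (l + 1)" by auto
  have zc: "(Z l)\<^sup>T *\<^sub>v vec l a \<in> carrier_vec (l + 1)" for a
    by (rule mult_mat_vec_carrier[OF zT vec_carrier])
  have "lift_C n l C *\<^sub>v stacked = vec (l + 1) y @\<^sub>v (Z l)\<^sup>T *\<^sub>v past_u"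
    unfolding lift_C_def mat_mult_append[OF c1 c2 stacked_carrier]
      append_cols3_mult_vec[OF eC zT zero_carrier_mat v]
      append_cols3_mult_vec[OF zero_carrier_mat zero_carrier_mat zT v]
      z1 right_zero_vec[OF zc] left_zero_vec[OF zc] newest_y
    ..
  moreover have "lift_D l *\<^sub>v ?u = 0\<^sub>v (l + 1) @\<^sub>v evec l 0 *\<^sub>v ?u"
    unfolding lift_D_def
    by (subst mat_mult_append[OF zero_carrier_mat evec_carrier]) (auto simp: z1)
  ultimately have "lift_CD n l C *\<^sub>v (stacked @\<^sub>v ?u)
      = (vec (l + 1) y @\<^sub>v (Z l)\<^sup>T *\<^sub>v past_u) + (0\<^sub>v (l + 1) @\<^sub>v evec l 0 *\<^sub>v ?u)"
    unfolding lift_CD_def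
    using append_cols_mult_vec[OF lift_C_carrier[OF C, of l, unfolded mult_2[of l]] lift_D_carrier stacked_carrier vec_carrier[of 1 "\<lambda>_. u 0"]]
    by (simp only:)
  also have "\<dots> = (vec (l + 1) y + 0\<^sub>v (l + 1)) @\<^sub>v ((Z l)\<^sup>T *\<^sub>v past_u + evec l 0 *\<^sub>v ?u)"
    by (rule append_vec_add[OF vec_carrier zero_carrier_vec zc mult_mat_vec_carrier[OF evec_carrier vec_carrier]])
  also have "\<dots> = vec (l + 1) y @\<^sub>v vec (l + 1) u" by (simp only: newest_u) simp
  finally show ?thesis .
qed

text \<open>In the upper half \<open>Zp\<close> discards the oldest entry after the current one has
  been prepended, which advances the memory by one step. The lower half repeats the old lifted
  state, so a block-diagonal form compares two consecutive times.\<close>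

lemma lift_AB_mult_vec:
  assumes A: "A \<in> carrier_mat n n" and B: "B \<in> carrier_mat n 1"
  shows "lift_AB n l A B C *\<^sub>v (stacked @\<^sub>v vec 1 (\<lambda>_. u 0)) =
    (vec n (\<lambda>i. (\<Sum>j<n. A $$ (i, j) * x j) + B $$ (i, 0) * u 0) @\<^sub>v vec l y @\<^sub>v vec l u) @\<^sub>v stacked"
proof -
  let ?e = "Zp l * evec l 0 * C" and ?s = "Zp l * (Z l)\<^sup>T" and ?u = "vec 1 (\<lambda>_. u 0)"
  let ?b = "Zp l * evec l 0"
  have zT: "(Z l)\<^sup>T \<in> carrier_mat (l + 1) l" by auto
  have b: "?b \<in> carrier_mat l 1" by (rule mult_carrier_mat[OF Zp_carrier evec_carrier])
  have e: "?e \<in> carrier_mat l n" by (rule mult_carrier_mat[OF b C])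
  have s: "?s \<in> carrier_mat l l" by (rule mult_carrier_mat[OF Zp_carrier zT])
  have eC: "evec l 0 * C \<in> carrier_mat (l + 1) n" by (rule mult_carrier_mat[OF evec_carrier C])
  have v: "vec n x \<in> carrier_vec n" "past_y \<in> carrier_vec l" "past_u \<in> carrier_vec l"
    and u: "?u \<in> carrier_vec 1" by auto
  note c1 = append_cols3_carrier[OF A zero_carrier_mat[of n l] zero_carrier_mat[of n l]]
  note c2 = append_cols3_carrier[OF e s zero_carrier_mat[of l l]]
  note c3 = append_cols3_carrier[OF zero_carrier_mat[of l n] zero_carrier_mat[of l l] s]
  have s_past: "?s *\<^sub>v vec l a = Zp l *\<^sub>v ((Z l)\<^sup>T *\<^sub>v vec l a)" for a
    by (rule assoc_mult_mat_vec[OF Zp_carrier zT]) auto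
  have ZTc: "(Z l)\<^sup>T *\<^sub>v vec l a \<in> carrier_vec (l + 1)" for a
    by (rule mult_mat_vec_carrier[OF zT]) auto
  have bc: "evec l 0 *\<^sub>v ?u \<in> carrier_vec (l + 1)"
    by (rule mult_mat_vec_carrier[OF evec_carrier u])
  have eCc: "(evec l 0 * C) *\<^sub>v vec n x \<in> carrier_vec (l + 1)"
    by (rule mult_mat_vec_carrier[OF eC v(1)])
  have "?e = Zp l * (evec l 0 * C)" by (rule assoc_mult_mat[OF Zp_carrier evec_carrier C])
  then have "?e *\<^sub>v vec n x = Zp l *\<^sub>v ((evec l 0 * C) *\<^sub>v vec n x)"
    using assoc_mult_mat_vec[OF Zp_carrier eC v(1)] by simp
  then have "?e *\<^sub>v vec n x + ?s *\<^sub>v past_y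
      = Zp l *\<^sub>v ((evec l 0 * C) *\<^sub>v vec n x + (Z l)\<^sup>T *\<^sub>v past_y)"
    by (simp only: s_past mult_add_distrib_mat_vec[OF Zp_carrier eCc ZTc])
  then have ey: "?e *\<^sub>v vec n x + ?s *\<^sub>v past_y = vec l y"
    unfolding newest_y by (simp only: Zp_mult_vec[OF vec_carrier]) (auto intro!: eq_vecI)
  have "?b *\<^sub>v ?u = Zp l *\<^sub>v (evec l 0 *\<^sub>v ?u)"
    by (rule assoc_mult_mat_vec[OF Zp_carrier evec_carrier u])
  then have "?s *\<^sub>v past_u + ?b *\<^sub>v ?u
      = Zp l *\<^sub>v ((Z l)\<^sup>T *\<^sub>v past_u + evec l 0 *\<^sub>v ?u)"
    by (simp only: s_past mult_add_distrib_mat_vec[OF Zp_carrier ZTc bc])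
  then have eu: "?s *\<^sub>v past_u + ?b *\<^sub>v ?u = vec l u"
    unfolding newest_u by (simp only: Zp_mult_vec[OF vec_carrier]) (auto intro!: eq_vecI)
  have AB: "A *\<^sub>v vec n x + B *\<^sub>v ?u = vec n (\<lambda>i. (\<Sum>j<n. A $$ (i, j) * x j) + B $$ (i, 0) * u 0)"
    using A B by (intro eq_vecI) (auto simp: scalar_prod_def lessThan_atLeast0)
  have Ac: "A *\<^sub>v vec n x \<in> carrier_vec n" and Bc: "B *\<^sub>v ?u \<in> carrier_vec n"
    and sc: "?s *\<^sub>v vec l a \<in> carrier_vec l"
    and b'c: "?b *\<^sub>v ?u \<in> carrier_vec l" for a
    using A B v u e s b by (auto intro!: mult_mat_vec_carrier simp del: assoc_mult_mat_vec)
  have z: "0\<^sub>m k q *\<^sub>v vec q a = 0\<^sub>v k" for k q and a :: "nat \<Rightarrow> real" by auto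
  have z0: "0\<^sub>v k + 0\<^sub>v k = (0\<^sub>v k :: real vec)" for k by simp
  have As: "lift_A n l A C *\<^sub>v stacked = A *\<^sub>v vec n x @\<^sub>v vec l y @\<^sub>v ?s *\<^sub>v past_u"
    unfolding lift_A_def append_rows3_mult_vec[OF c1 c2 c3 stacked_carrier]
      append_cols3_mult_vec[OF A zero_carrier_mat zero_carrier_mat v]
      append_cols3_mult_vec[OF e s zero_carrier_mat v]
      append_cols3_mult_vec[OF zero_carrier_mat zero_carrier_mat s v]
      z z0 right_zero_vec[OF Ac] right_zero_vec[OF sc] left_zero_vec[OF sc] ey ..
  have Bu: "lift_B l B *\<^sub>v ?u = B *\<^sub>v ?u @\<^sub>v 0\<^sub>v l @\<^sub>v ?b *\<^sub>v ?u"
    unfolding lift_B_def append_rows3_mult_vec[OF B zero_carrier_mat b u] z ..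
  have top: "lift_A n l A C *\<^sub>v stacked + lift_B l B *\<^sub>v ?u
      = vec n (\<lambda>i. (\<Sum>j<n. A $$ (i, j) * x j) + B $$ (i, 0) * u 0) @\<^sub>v vec l y @\<^sub>v vec l u"
    unfolding As Bu append_vec_add[OF Ac Bc append_carrier_vec[OF vec_carrier sc] append_carrier_vec[OF zero_carrier_vec b'c]]
      append_vec_add[OF vec_carrier zero_carrier_vec sc b'c] AB eu
    by simp
  have bot: "1\<^sub>m (n + (l + l)) *\<^sub>v stacked + 0\<^sub>m (n + (l + l)) 1 *\<^sub>v ?u = stacked"
    unfolding one_mult_mat_vec[OF stacked_carrier] z right_zero_vec[OF stacked_carrier] ..
  show ?thesis
    unfolding lift_AB_def mult_2
    by (subst four_block_mat_mult_vec[OF lift_A_carrier[OF A C, unfolded mult_2] lift_B_carrier[OF B, unfolded mult_2]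
          one_carrier_mat zero_carrier_mat stacked_carrier u]) (simp only: top bot)
qed

end

section \<open>Multiplier matrices as sums over pairs of points\<close>

lemma smult_mult_vec:
  "v \<in> carrier_vec (dim_col M) \<Longrightarrow> (c \<cdot>\<^sub>m M) *\<^sub>v v = c \<cdot>\<^sub>v ((M :: real mat) *\<^sub>v v)"
  by (intro eq_vecI) auto

lemma scalar_prod_outer:
  fixes P Q :: "real mat"
  assumes P: "P \<in> carrier_mat k 1" and Q: "Q \<in> carrier_mat k 1"
    and v: "v \<in> carrier_vec k" and w: "w \<in> carrier_vec k"
  shows "v \<bullet> ((P * Q\<^sup>T) *\<^sub>v w) = (P\<^sup>T *\<^sub>v v) $ 0 * (Q\<^sup>T *\<^sub>v w) $ 0"
proof -
  have QT: "Q\<^sup>T \<in> carrier_mat 1 k" using Q by simp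
  have Qw: "Q\<^sup>T *\<^sub>v w \<in> carrier_vec 1" by (rule mult_mat_vec_carrier[OF QT w])
  have "v \<bullet> ((P * Q\<^sup>T) *\<^sub>v w) = v \<bullet> (P *\<^sub>v (Q\<^sup>T *\<^sub>v w))"
    using assoc_mult_mat_vec[OF P QT w] by simp
  also have "\<dots> = (P\<^sup>T *\<^sub>v v) \<bullet> (Q\<^sup>T *\<^sub>v w)"
    using transpose_vec_mult_scalar[OF P Qw v] by simp
  also have "\<dots> = (P\<^sup>T *\<^sub>v v) $ 0 * (Q\<^sup>T *\<^sub>v w) $ 0"
    by (simp add: scalar_prod_def[of "P\<^sup>T *\<^sub>v v"] carrier_matD(2)[OF Q] carrier_matD(2)[OF P])
  finally show ?thesis .
qed

text \<open>The star index needs no case of its own: there \<open>evec\<close> is the zero column,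
  which agrees with \<open>y (Suc l) = 0\<close>.\<close>

lemma evec_combination:
  fixes G :: "real mat"
  assumes G: "G \<in> carrier_mat (l + 1) 1"
    and entries: "\<And>k. k < l + 1 \<Longrightarrow> G $$ (k, 0) = a * (if k = i then 1 else 0) - b * (if k = j then 1 else 0)"
    and ij: "i < l + 2" "j < l + 2" and y: "y (Suc l) = 0"
  shows "(G\<^sup>T *\<^sub>v vec (l + 1) y) $ 0 = a * y i - b * y j"
proof -
  have pick: "(\<Sum>k<l + 1. (if k = i then 1 else 0) * y k) = y i" if "i < l + 2" for i
    using that y by (cases "i = Suc l") (auto simp: if_distrib[of "\<lambda>c. c * _"] cong: if_cong)
  have "(G\<^sup>T *\<^sub>v vec (l + 1) y) $ 0 = (\<Sum>k<l + 1. G $$ (k, 0) * y k)"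
    using G by (simp add: scalar_prod_def lessThan_atLeast0)
  also have "\<dots> = (\<Sum>k<l + 1. a * ((if k = i then 1 else 0) * y k) - b * ((if k = j then 1 else 0) * y k))"
    by (intro sum.cong refl) (simp only: entries lessThan_iff left_diff_distrib mult.assoc)
  also have "\<dots> = a * y i - b * y j"
    unfolding sum_subtractf sum_distrib_left[symmetric] using pick ij by simp
  finally show ?thesis .
qed

lemma Pi_block_carrier [simp]: "Pi_block m L l i j \<in> carrier_mat (2 * (l + 1)) (2 * (l + 1))"
  by (intro carrier_matI) (auto simp: Pi_block_def Let_def)

text \<open>Every block is a product of a column and a row, so its form factors into two scalars,
  each the value of \<open>d\<close> or \<open>g\<close> on the outputs or on the gradients.\<close>

lemma Pi_block_form:
  assumes ij: "i < l + 2" "j < l + 2" and y: "y (Suc l) = 0" and u: "u (Suc l) = 0"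
  shows "(vec (l + 1) y @\<^sub>v vec (l + 1) u) \<bullet> (Pi_block m L l i j *\<^sub>v (vec (l + 1) y @\<^sub>v vec (l + 1) u))
    = pair_form m L y u i j"
proof -
  define d where "d = evec l i - evec l j"
  define g where "g = m \<cdot>\<^sub>m evec l i - L \<cdot>\<^sub>m evec l j"
  let ?y = "vec (l + 1) y" and ?u = "vec (l + 1) u"
  have d: "d \<in> carrier_mat (l + 1) 1" and g: "g \<in> carrier_mat (l + 1) 1"
    by (auto simp: d_def g_def)
  have dy: "(d\<^sup>T *\<^sub>v ?y) $ 0 = y i - y j" and du: "(d\<^sup>T *\<^sub>v ?u) $ 0 = u i - u j"
    using evec_combination[where a = 1 and b = 1 and y = y, OF d _ ij y]
      evec_combination[where a = 1 and b = 1 and y = u, OF d _ ij u]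
    by (simp_all add: d_def evec_def)
  have gu: "(g\<^sup>T *\<^sub>v ?u) $ 0 = m * u i - L * u j"
    by (rule evec_combination[where a = m and b = L and y = u, OF g _ ij u]) (simp add: g_def evec_def)
  have dd: "d * d\<^sup>T \<in> carrier_mat (l + 1) (l + 1)" and dg: "d * g\<^sup>T \<in> carrier_mat (l + 1) (l + 1)"
    and gd: "g * d\<^sup>T \<in> carrier_mat (l + 1) (l + 1)"
    using d g by (auto intro!: mult_carrier_mat)
  have v: "?y \<in> carrier_vec (l + 1)" "?u \<in> carrier_vec (l + 1)" by auto
  have mv: "M *\<^sub>v w \<in> carrier_vec (l + 1)"
    if "M \<in> carrier_mat (l + 1) (l + 1)" "w \<in> carrier_vec (l + 1)" for M :: "real mat" and w
    using that by (rule mult_mat_vec_carrier)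
  have s: "(c \<cdot>\<^sub>m (d * d\<^sup>T)) *\<^sub>v ?y = c \<cdot>\<^sub>v ((d * d\<^sup>T) *\<^sub>v ?y)" for c
    by (rule smult_mult_vec) (simp add: carrier_matD[OF d])
  have m: "- (d * d\<^sup>T) *\<^sub>v ?u = - ((d * d\<^sup>T) *\<^sub>v ?u)"
    by (rule uminus_mult_mat_vec) (simp add: carrier_matD[OF d])
  have "Pi_block m L l i j *\<^sub>v (?y @\<^sub>v ?u)
      = ((- m * L) \<cdot>\<^sub>v ((d * d\<^sup>T) *\<^sub>v ?y) + (d * g\<^sup>T) *\<^sub>v ?u) @\<^sub>v ((g * d\<^sup>T) *\<^sub>v ?y + - ((d * d\<^sup>T) *\<^sub>v ?u))"
    unfolding Pi_block_def Let_def d_def[symmetric] g_def[symmetric]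
      four_block_mat_mult_vec[OF smult_carrier_mat[OF dd] dg gd uminus_carrier_mat[OF dd] v] s m ..
  moreover have "(?y @\<^sub>v ?u) \<bullet> \<dots> = ?y \<bullet> ((- m * L) \<cdot>\<^sub>v ((d * d\<^sup>T) *\<^sub>v ?y) + (d * g\<^sup>T) *\<^sub>v ?u)
      + ?u \<bullet> ((g * d\<^sup>T) *\<^sub>v ?y + - ((d * d\<^sup>T) *\<^sub>v ?u))"
    by (rule scalar_prod_append[OF v])
      (intro add_carrier_vec smult_carrier_vec[THEN iffD2] uminus_carrier_vec[THEN iffD2] mv dd dg gd v)+
  moreover have "?y \<bullet> ((- m * L) \<cdot>\<^sub>v ((d * d\<^sup>T) *\<^sub>v ?y) + (d * g\<^sup>T) *\<^sub>v ?u)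
      = - m * L * (?y \<bullet> ((d * d\<^sup>T) *\<^sub>v ?y)) + ?y \<bullet> ((d * g\<^sup>T) *\<^sub>v ?u)"
    using scalar_prod_add_distrib[OF v(1) smult_carrier_vec[THEN iffD2, OF mv[OF dd v(1)]] mv[OF dg v(2)]]
      scalar_prod_smult_distrib[OF v(1) mv[OF dd v(1)]] by simp
  moreover have "?u \<bullet> ((g * d\<^sup>T) *\<^sub>v ?y + - ((d * d\<^sup>T) *\<^sub>v ?u))
      = ?u \<bullet> ((g * d\<^sup>T) *\<^sub>v ?y) - ?u \<bullet> ((d * d\<^sup>T) *\<^sub>v ?u)"
    using scalar_prod_add_distrib[OF v(2) mv[OF gd v(1)] uminus_carrier_vec[THEN iffD2, OF mv[OF dd v(2)]]]
      scalar_prod_uminus_right[of ?u "(d * d\<^sup>T) *\<^sub>v ?u"] carrier_vecD[OF mv[OF dd v(2)]]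
    by (simp only: dim_vec diff_conv_add_uminus)
  ultimately show ?thesis
    by (simp only: scalar_prod_outer[OF d d v(1) v(1)] scalar_prod_outer[OF d g v(1) v(2)]
        scalar_prod_outer[OF g d v(2) v(1)] scalar_prod_outer[OF d d v(2) v(2)] dy du gu)
      (simp add: pair_form_def scalar_prod_outer power2_eq_square gu algebra_simps)
qed

lemma sum_rotate:
  "(\<Sum>c\<in>R. \<Sum>i\<in>I. \<Sum>j\<in>J. F c i j) = (\<Sum>i\<in>I. \<Sum>j\<in>J. \<Sum>c\<in>R. F c i j)"
  by (rule trans[OF sum.swap sum.cong[OF refl sum.swap]])

lemma sum_swap_pairs:
  fixes F :: "'a \<Rightarrow> 'b \<Rightarrow> 'c \<Rightarrow> 'd \<Rightarrow> 'e :: comm_monoid_add"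
  shows "(\<Sum>a\<in>R. \<Sum>b\<in>S. \<Sum>i\<in>I. \<Sum>j\<in>J. F a b i j) = (\<Sum>i\<in>I. \<Sum>j\<in>J. \<Sum>a\<in>R. \<Sum>b\<in>S. F a b i j)"
proof -
  have pairs: "(\<Sum>a\<in>R. \<Sum>b\<in>S. H a b) = (\<Sum>p\<in>R \<times> S. H (fst p) (snd p))" for R S and H :: "_ \<Rightarrow> _ \<Rightarrow> 'e"
    by (simp add: sum.cartesian_product split_def)
  show ?thesis
    unfolding pairs[of _ J] pairs[of _ S] by (rule sum.swap)
qed

lemma Pi_mult_form:
  assumes y: "y (Suc l) = 0" and u: "u (Suc l) = 0"
  shows "(vec (l + 1) (y :: nat \<Rightarrow> real) @\<^sub>v vec (l + 1) u) \<bullet> (Pi_mult m L l \<Lambda> *\<^sub>v (vec (l + 1) y @\<^sub>v vec (l + 1) u))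
    = multiplier_form m L l \<Lambda> y u"
proof -
  define N where "N = 2 * (l + 1)"
  define z where "z = (\<lambda>k. (vec (l + 1) y @\<^sub>v vec (l + 1) u) $ k)"
  have z: "vec (l + 1) y @\<^sub>v vec (l + 1) u = vec N z"
    by (rule eq_vecI) (auto simp: z_def N_def)
  have blk: "gram_form (Pi_block m L l i j) N z = pair_form m L y u i j"
    if "i < l + 2" "j < l + 2" for i j
    using Pi_block_form[where m = m and L = L and y = y and u = u, OF that y u] scalar_prod_mat_vec[OF Pi_block_carrier[of m L l i j], of z]
    unfolding z N_def[symmetric] by simp
  have entry: "Pi_mult m L l \<Lambda> $$ (a, b) = (\<Sum>i<l + 2. \<Sum>j<l + 2. \<Lambda> $$ (i, j) * Pi_block m L l i j $$ (a, b))"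
    if "a < N" "b < N" for a b
    using that unfolding Pi_mult_def N_def by (subst index_mat) (simp_all only: prod.case)
  have "vec N z \<bullet> (Pi_mult m L l \<Lambda> *\<^sub>v vec N z) = gram_form (Pi_mult m L l \<Lambda>) N z"
    by (rule scalar_prod_mat_vec) (simp add: Pi_mult_def N_def)
  also have "\<dots> = (\<Sum>a<N. \<Sum>b<N. \<Sum>i<l + 2. \<Sum>j<l + 2.
      \<Lambda> $$ (i, j) * (Pi_block m L l i j $$ (a, b) * inner (z a) (z b)))"
    unfolding gram_form_def
    by (intro sum.cong refl) (simp only: entry lessThan_iff sum_distrib_right mult.assoc)
  also have "\<dots> = (\<Sum>i<l + 2. \<Sum>j<l + 2. \<Sum>a<N. \<Sum>b<N.
      \<Lambda> $$ (i, j) * (Pi_block m L l i j $$ (a, b) * inner (z a) (z b)))"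
    by (rule sum_swap_pairs)
  also have "\<dots> = multiplier_form m L l \<Lambda> y u"
    unfolding multiplier_form_def sum_distrib_left[symmetric]
    using blk by (intro sum.cong refl) (simp add: gram_form_def)
  finally show ?thesis unfolding z .
qed

section \<open>Terms of the matrix inequalities evaluated on a lifted vector\<close>

definition next_state :: "nat \<Rightarrow> real mat \<Rightarrow> real mat \<Rightarrow> (nat \<Rightarrow> 'a) \<Rightarrow> 'a \<Rightarrow> nat \<Rightarrow> 'a::real_vector" where
  "next_state n A B x v i = (\<Sum>j<n. A $$ (i, j) *\<^sub>R x j) + B $$ (i, 0) *\<^sub>R v"

text \<open>The current gradient comes last, as the input to the columns of \<open>lift_B\<close>
  and \<open>lift_D\<close>. The entry \<open>y 0\<close> does not occur, since the state determines
  it.\<close>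

definition lifted :: "nat \<Rightarrow> nat \<Rightarrow> (nat \<Rightarrow> real) \<Rightarrow> (nat \<Rightarrow> real) \<Rightarrow> (nat \<Rightarrow> real) \<Rightarrow> real vec" where
  "lifted n l x y u = vec (n + 2 * l) (stack n l x (\<lambda>k. y (Suc k)) (\<lambda>k. u (Suc k))) @\<^sub>v vec 1 (\<lambda>_. u 0)"

lemma lifted_carrier [simp, intro]: "lifted n l x y u \<in> carrier_vec (n + 2 * l + 1)"
  unfolding lifted_def by (intro append_carrier_vec vec_carrier)

text \<open>With \<open>Q\<close> a negative multiple of \<open>P\<close>, the right-hand side is
  the quadratic part of the new storage minus that multiple of the old one.\<close>

lemma quadratic_lift_AB:
  fixes x y u :: "nat \<Rightarrow> real"
  assumes A: "A \<in> carrier_mat n n" and B: "B \<in> carrier_mat n 1" and C: "C \<in> carrier_mat 1 n"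
    and y0: "y 0 = (\<Sum>j<n. C $$ (0, j) * x j)"
    and P: "P \<in> carrier_mat (n + 2 * l) (n + 2 * l)" and Q: "Q \<in> carrier_mat (n + 2 * l) (n + 2 * l)"
  defines "v \<equiv> lifted n l x y u"
  shows "v \<bullet> (((lift_AB n l A B C)\<^sup>T * block_diag2 P Q * lift_AB n l A B C) *\<^sub>v v)
     = gram_form P (n + 2 * l) (stack n l (next_state n A B x (u 0)) y u)
       + gram_form Q (n + 2 * l) (stack n l x (\<lambda>k. y (Suc k)) (\<lambda>k. u (Suc k)))"
proof -
  let ?N = "n + 2 * l"
  let ?a = "vec ?N (stack n l (next_state n A B x (u 0)) y u)"
  let ?b = "vec ?N (stack n l x (\<lambda>k. y (Suc k)) (\<lambda>k. u (Suc k)))"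
  have v: "v \<in> carrier_vec (?N + 1)" unfolding v_def by (rule lifted_carrier)
  have D: "block_diag2 P Q = four_block_mat P (0\<^sub>m ?N ?N) (0\<^sub>m ?N ?N) Q"
    unfolding block_diag2_def carrier_matD[OF P] carrier_matD[OF Q] ..
  have Dc: "block_diag2 P Q \<in> carrier_mat (?N + ?N) (?N + ?N)"
    unfolding D by (rule four_block_carrier_mat[OF P Q])
  have ABc: "lift_AB n l A B C \<in> carrier_mat (?N + ?N) (?N + 1)"
    unfolding lift_AB_def by (rule four_block_carrier_mat[OF lift_A_carrier[OF A C] zero_carrier_mat])
  have ABv: "lift_AB n l A B C *\<^sub>v v = ?a @\<^sub>v ?b"
    unfolding v_def lifted_def vec_stack lift_AB_mult_vec[where x = x and y = y and u = u, OF C y0 A B]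
    by (simp add: next_state_def[abs_def])
  have "v \<bullet> (((lift_AB n l A B C)\<^sup>T * block_diag2 P Q * lift_AB n l A B C) *\<^sub>v v)
      = (?a @\<^sub>v ?b) \<bullet> (block_diag2 P Q *\<^sub>v (?a @\<^sub>v ?b))"
    unfolding quadratic_congruence[OF Dc ABc v] ABv ..
  also have "block_diag2 P Q *\<^sub>v (?a @\<^sub>v ?b) = P *\<^sub>v ?a @\<^sub>v Q *\<^sub>v ?b"
  proof -
    have z: "0\<^sub>m ?N ?N *\<^sub>v vec ?N w = 0\<^sub>v ?N" for w :: "nat \<Rightarrow> real" by auto
    show ?thesis
      unfolding D four_block_mat_mult_vec[OF P zero_carrier_mat zero_carrier_mat Q vec_carrier vec_carrier] z
        right_zero_vec[OF mult_mat_vec_carrier[OF P vec_carrier]]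
        left_zero_vec[OF mult_mat_vec_carrier[OF Q vec_carrier]] ..
  qed
  also have "(?a @\<^sub>v ?b) \<bullet> (P *\<^sub>v ?a @\<^sub>v Q *\<^sub>v ?b) = ?a \<bullet> (P *\<^sub>v ?a) + ?b \<bullet> (Q *\<^sub>v ?b)"
    by (rule scalar_prod_append[OF vec_carrier vec_carrier mult_mat_vec_carrier[OF P vec_carrier]
          mult_mat_vec_carrier[OF Q vec_carrier]])
  finally show ?thesis unfolding scalar_prod_mat_vec[OF P] scalar_prod_mat_vec[OF Q] .
qed

lemma lift_CD_carrier:
  assumes "C \<in> carrier_mat 1 n"
  shows "lift_CD n l C \<in> carrier_mat (2 * (l + 1)) (n + 2 * l + 1)"
  unfolding lift_CD_def
  by (rule append_cols_carrier[OF lift_C_carrier[OF assms] lift_D_carrier])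

lemma quadratic_lift_CD:
  fixes x y u :: "nat \<Rightarrow> real"
  assumes C: "C \<in> carrier_mat 1 n"
    and y0: "y 0 = (\<Sum>j<n. C $$ (0, j) * x j)" and y: "y (Suc l) = 0" and u: "u (Suc l) = 0"
  defines "v \<equiv> lifted n l x y u"
  shows "v \<bullet> (((lift_CD n l C)\<^sup>T * Pi_mult m L l \<Lambda> * lift_CD n l C) *\<^sub>v v) = multiplier_form m L l \<Lambda> y u"
proof -
  have v: "v \<in> carrier_vec (n + 2 * l + 1)" unfolding v_def by (rule lifted_carrier)
  have M: "Pi_mult m L l \<Lambda> \<in> carrier_mat (2 * (l + 1)) (2 * (l + 1))" by (simp add: Pi_mult_def)
  have CDv: "lift_CD n l C *\<^sub>v v = vec (l + 1) y @\<^sub>v vec (l + 1) u"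
    unfolding v_def lifted_def vec_stack by (rule lift_CD_mult_vec[where x = x and y = y and u = u, OF C y0])
  show ?thesis
    unfolding quadratic_congruence[OF M lift_CD_carrier[OF C] v] CDv by (rule Pi_mult_form[where y = y and u = u, OF y u])
qed

lemma quadratic_lift_I0:
  fixes x y u :: "nat \<Rightarrow> real"
  assumes P: "P \<in> carrier_mat (n + 2 * l) (n + 2 * l)"
  defines "v \<equiv> lifted n l x y u"
  shows "v \<bullet> (((lift_I0 n l)\<^sup>T * P * lift_I0 n l) *\<^sub>v v)
    = gram_form P (n + 2 * l) (stack n l x (\<lambda>k. y (Suc k)) (\<lambda>k. u (Suc k)))"
proof -
  let ?N = "n + 2 * l"
  have v: "v \<in> carrier_vec (?N + 1)" unfolding v_def by (rule lifted_carrier)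
  have I: "lift_I0 n l \<in> carrier_mat ?N (?N + 1)" 
    unfolding lift_I0_def by (rule append_cols_carrier[OF one_carrier_mat zero_carrier_mat])
  have z: "0\<^sub>m ?N 1 *\<^sub>v vec 1 w = 0\<^sub>v ?N" for w :: "nat \<Rightarrow> real" by auto
  have Iv: "lift_I0 n l *\<^sub>v v = vec ?N (stack n l x (\<lambda>k. y (Suc k)) (\<lambda>k. u (Suc k)))"
    unfolding v_def lifted_def lift_I0_def
      append_cols_mult_vec[OF one_carrier_mat zero_carrier_mat vec_carrier vec_carrier]
      one_mult_mat_vec[OF vec_carrier] z right_zero_vec[OF vec_carrier] ..
  show ?thesis unfolding quadratic_congruence[OF P I v] Iv by (rule scalar_prod_mat_vec[OF P])
qed

lemma quadratic_gram:
  fixes G :: "real mat"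
  assumes G: "G \<in> carrier_mat k N" and v: "v \<in> carrier_vec N"
  shows "v \<bullet> ((G\<^sup>T * G) *\<^sub>v v) = (G *\<^sub>v v) \<bullet> (G *\<^sub>v v)"
proof -
  have w: "G *\<^sub>v v \<in> carrier_vec k" by (rule mult_mat_vec_carrier[OF G v])
  have GT: "G\<^sup>T \<in> carrier_mat N k" using G by simp
  have "v \<bullet> ((G\<^sup>T * G) *\<^sub>v v) = v \<bullet> (G\<^sup>T *\<^sub>v (G *\<^sub>v v))"
    by (simp only: assoc_mult_mat_vec[OF GT G v])
  also have "\<dots> = (G\<^sup>T *\<^sub>v (G *\<^sub>v v)) \<bullet> v"
    by (rule comm_scalar_prod[OF v mult_mat_vec_carrier[OF GT w]])
  also have "\<dots> = (G *\<^sub>v v) \<bullet> (G *\<^sub>v v)" by (rule transpose_vec_mult_scalar[OF G v w])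
  finally show ?thesis .
qed

lemma lifted_state_mult_vec:
  assumes G: "G \<in> carrier_mat k n"
  shows "(G @\<^sub>c 0\<^sub>m k (2 * l + 1)) *\<^sub>v lifted n l x y u = G *\<^sub>v vec n x"
proof -
  let ?w = "(vec l (\<lambda>k. y (Suc k)) @\<^sub>v vec l (\<lambda>k. u (Suc k))) @\<^sub>v vec 1 (\<lambda>_. u 0)"
  have w: "?w \<in> carrier_vec (2 * l + 1)"
    unfolding mult_2 by (intro append_carrier_vec vec_carrier)
  have "lifted n l x y u = vec n x @\<^sub>v ?w"
    unfolding lifted_def vec_stack by (rule eq_vecI) auto
  moreover have "0\<^sub>m k (2 * l + 1) *\<^sub>v ?w = 0\<^sub>v k" using w by (intro eq_vecI) auto
  ultimately show ?thesis
    by (simp only: append_cols_mult_vec[OF G zero_carrier_mat vec_carrier w]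
        right_zero_vec[OF mult_mat_vec_carrier[OF G vec_carrier]])
qed

lemma quadratic_lift_X:
  fixes x y u :: "nat \<Rightarrow> real" and n l :: nat
  defines "v \<equiv> lifted n l x y u"
  shows "v \<bullet> (((lift_X n l)\<^sup>T * lift_X n l) *\<^sub>v v) = (\<Sum>i<n. (x i)\<^sup>2)"
proof -
  have X: "lift_X n l \<in> carrier_mat n (n + 2 * l + 1)"
    using append_cols_carrier[OF one_carrier_mat zero_carrier_mat, of n "2 * l + 1"]
    by (simp add: lift_X_def add.assoc)
  have v: "v \<in> carrier_vec (n + 2 * l + 1)" unfolding v_def by (rule lifted_carrier)
  have "lift_X n l *\<^sub>v v = vec n x"
    unfolding lift_X_def v_def lifted_state_mult_vec[OF one_carrier_mat] by (rule one_mult_mat_vec) simp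
  then show ?thesis
    unfolding quadratic_gram[OF X v] by (simp add: scalar_prod_def lessThan_atLeast0 power2_eq_square)
qed

lemma quadratic_lift_Y:
  fixes x y u :: "nat \<Rightarrow> real" and n l :: nat
  assumes C: "C \<in> carrier_mat 1 n"
    and y0: "y 0 = (\<Sum>j<n. C $$ (0, j) * x j)"
  defines "v \<equiv> lifted n l x y u"
  shows "v \<bullet> (((lift_Y l C)\<^sup>T * lift_Y l C) *\<^sub>v v) = (y 0)\<^sup>2"
proof -
  have Y: "lift_Y l C \<in> carrier_mat 1 (n + 2 * l + 1)"
    using append_cols_carrier[OF C zero_carrier_mat, of "2 * l + 1"]
    by (simp add: lift_Y_def add.assoc)
  have v: "v \<in> carrier_vec (n + 2 * l + 1)" unfolding v_def by (rule lifted_carrier)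
  have "lift_Y l C *\<^sub>v v = vec 1 (\<lambda>_. y 0)"
    unfolding lift_Y_def v_def lifted_state_mult_vec[OF C]
    using C y0 by (intro eq_vecI) (auto simp: scalar_prod_def lessThan_atLeast0)
  then show ?thesis
    unfolding quadratic_gram[OF Y v] by (simp add: scalar_prod_def power2_eq_square)
qed

lemma gram_form_smult:
  "M \<in> carrier_mat N N \<Longrightarrow> gram_form (c \<cdot>\<^sub>m M) N x = c * gram_form M N x"
  unfolding gram_form_def by (auto simp: sum_distrib_left mult.assoc intro!: sum.cong)

text \<open>This and the two analogous facts below carry inequalities for real data over to data in
  \<open>real ^ 'd\<close>: an inner product is the sum of the products of coordinates.\<close>

lemma gram_form_components:
  fixes x :: "nat \<Rightarrow> real ^ 'd"
  shows "gram_form M N x = (\<Sum>c\<in>UNIV. gram_form M N (\<lambda>i. vec_nth (x i) c))"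
  unfolding gram_form_def
  by (simp only: sum_rotate[of _ _ _ UNIV] inner_vec_def sum_distrib_left)

lemma pair_form_components:
  fixes y u :: "nat \<Rightarrow> real ^ 'd"
  shows "pair_form m L y u i j = (\<Sum>c\<in>UNIV. pair_form m L (\<lambda>i. vec_nth (y i) c) (\<lambda>i. vec_nth (u i) c) i j)"
  unfolding pair_form_def power2_norm_eq_inner
  by (simp add: inner_vec_def sum_distrib_left sum.distrib sum_subtractf sum_negf)

lemma multiplier_form_components:
  fixes y u :: "nat \<Rightarrow> real ^ 'd"
  shows "multiplier_form m L l \<Lambda> y u
    = (\<Sum>c\<in>UNIV. multiplier_form m L l \<Lambda> (\<lambda>i. vec_nth (y i) c) (\<lambda>i. vec_nth (u i) c))"
  unfolding multiplier_form_def
  by (simp only: sum_rotate[of _ _ _ UNIV] pair_form_components[of m L y u] sum_distrib_left)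

lemma stack_component:
  "vec_nth (stack n l x a b i) c
    = stack n l (\<lambda>i. vec_nth (x i) c) (\<lambda>i. vec_nth (a i) c) (\<lambda>i. vec_nth (b i) c) i"
  by (simp add: stack_def)

lemma next_state_component:
  fixes x :: "nat \<Rightarrow> real ^ 'd"
  shows "vec_nth (next_state n A B x v i) c = next_state n A B (\<lambda>i. vec_nth (x i) c) (vec_nth v c) i"
  by (simp add: next_state_def)

lemma neg_semidefD:
  "neg_semidef M \<Longrightarrow> M \<in> carrier_mat N N \<Longrightarrow> v \<in> carrier_vec N \<Longrightarrow> v \<bullet> (M *\<^sub>v v) \<le> 0"
  by (auto simp: neg_semidef_def)

lemma quadratic_add:
  fixes M M' :: "real mat"
  assumes M: "M \<in> carrier_mat N N" and M': "M' \<in> carrier_mat N N" and v: "v \<in> carrier_vec N"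
  shows "v \<bullet> ((M + M') *\<^sub>v v) = v \<bullet> (M *\<^sub>v v) + v \<bullet> (M' *\<^sub>v v)"
  unfolding add_mult_distrib_mat_vec[OF M M' v]
  by (rule scalar_prod_add_distrib[OF v mult_mat_vec_carrier[OF M v] mult_mat_vec_carrier[OF M' v]])

lemma quadratic_uminus:
  fixes M :: "real mat"
  assumes M: "M \<in> carrier_mat N N" and v: "v \<in> carrier_vec N"
  shows "v \<bullet> ((- M) *\<^sub>v v) = - (v \<bullet> (M *\<^sub>v v))"
proof -
  have "(- M) *\<^sub>v v = - (M *\<^sub>v v)" using M v by (intro uminus_mult_mat_vec) auto
  then show ?thesis using M v by (simp add: scalar_prod_uminus_right)
qed

text \<open>The elementwise inequality is paired with the vector of function gaps, which keeps its
  sign because gaps are nonnegative. Transposition moves \<open>W\<close> from \<open>p\<close> to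
  the gaps; the gap at the star index is zero, matching the zero column there.\<close>

lemma linear_multiplier_form:
  assumes W: "W \<in> carrier_mat l (l + 1)" and p: "p \<in> carrier_vec l"
    and le: "W\<^sup>T *\<^sub>v p + pi_mult m L l \<Lambda> \<le> 0\<^sub>v (l + 1)"
    and nonneg: "\<And>k. k \<le> l \<Longrightarrow> 0 \<le> \<phi> k" and star: "\<phi> (Suc l) = 0"
  shows "p \<bullet> (W *\<^sub>v vec (l + 1) \<phi>) + 2 * (L - m) * (\<Sum>i<l + 2. \<Sum>j<l + 2. \<Lambda> $$ (i, j) * (\<phi> i - \<phi> j)) \<le> 0"
proof -
  let ?\<phi> = "vec (l + 1) \<phi>"
  have WT: "W\<^sup>T \<in> carrier_mat (l + 1) l" using W by simp
  have Wp: "W\<^sup>T *\<^sub>v p \<in> carrier_vec (l + 1)" by (rule mult_mat_vec_carrier[OF WT p])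
  have pi: "pi_mult m L l \<Lambda> \<in> carrier_vec (l + 1)" by (simp add: pi_mult_def)
  have "(W\<^sup>T *\<^sub>v p + pi_mult m L l \<Lambda>) \<bullet> ?\<phi> \<le> 0"
    unfolding scalar_prod_def
  proof (rule sum_nonpos)
    fix k assume k: "k \<in> {0..<dim_vec ?\<phi>}"
    then have "(W\<^sup>T *\<^sub>v p + pi_mult m L l \<Lambda>) $ k \<le> 0"
      using le by (auto simp: less_eq_vec_def)
    then show "(W\<^sup>T *\<^sub>v p + pi_mult m L l \<Lambda>) $ k * ?\<phi> $ k \<le> 0"
      using k nonneg[of k] by (simp add: mult_nonpos_nonneg)
  qed
  moreover have "(W\<^sup>T *\<^sub>v p + pi_mult m L l \<Lambda>) \<bullet> ?\<phi> = (W\<^sup>T *\<^sub>v p) \<bullet> ?\<phi> + pi_mult m L l \<Lambda> \<bullet> ?\<phi>"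
    by (rule add_scalar_prod_distrib[OF Wp pi vec_carrier])
  moreover have "(W\<^sup>T *\<^sub>v p) \<bullet> ?\<phi> = p \<bullet> (W *\<^sub>v ?\<phi>)"
    by (rule transpose_vec_mult_scalar[OF W vec_carrier p])
  moreover have "pi_mult m L l \<Lambda> \<bullet> ?\<phi>
      = 2 * (L - m) * (\<Sum>i<l + 2. \<Sum>j<l + 2. \<Lambda> $$ (i, j) * (\<phi> i - \<phi> j))"
  proof -
    have diff: "(\<Sum>k<l + 1. (evec l i - evec l j) $$ (k, 0) * \<phi> k) = \<phi> i - \<phi> j"
      if "i < l + 2" "j < l + 2" for i j
    proof -
      have G: "evec l i - evec l j \<in> carrier_mat (l + 1) 1" by auto
      have "((evec l i - evec l j)\<^sup>T *\<^sub>v ?\<phi>) $ 0 = 1 * \<phi> i - 1 * \<phi> j"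
        by (rule evec_combination[where y = \<phi>, OF G _ that star]) (simp add: evec_def)
      moreover have "((evec l i - evec l j)\<^sup>T *\<^sub>v ?\<phi>) $ 0 = (\<Sum>k<l + 1. (evec l i - evec l j) $$ (k, 0) * \<phi> k)"
        by (simp add: scalar_prod_def lessThan_atLeast0)
      ultimately show ?thesis by simp
    qed
    have "pi_mult m L l \<Lambda> \<bullet> ?\<phi> = (\<Sum>k<l + 1. 2 * (L - m) *
        (\<Sum>i<l + 2. \<Sum>j<l + 2. \<Lambda> $$ (i, j) * (evec l i - evec l j) $$ (k, 0)) * \<phi> k)"
      unfolding scalar_prod_def dim_vec pi_mult_def
      by (intro sum.cong) (simp_all only: lessThan_atLeast0 index_vec atLeastLessThan_iff)
    also have "\<dots> = 2 * (L - m) * (\<Sum>k<l + 1. \<Sum>i<l + 2. \<Sum>j<l + 2.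
        \<Lambda> $$ (i, j) * ((evec l i - evec l j) $$ (k, 0) * \<phi> k))"
      by (simp only: sum_distrib_left sum_distrib_right mult.assoc)
    also have "(\<Sum>k<l + 1. \<Sum>i<l + 2. \<Sum>j<l + 2. \<Lambda> $$ (i, j) * ((evec l i - evec l j) $$ (k, 0) * \<phi> k))
        = (\<Sum>i<l + 2. \<Sum>j<l + 2. \<Sum>k<l + 1. \<Lambda> $$ (i, j) * ((evec l i - evec l j) $$ (k, 0) * \<phi> k))"
      by (rule sum_rotate)
    also have "\<dots> = (\<Sum>i<l + 2. \<Sum>j<l + 2. \<Lambda> $$ (i, j) * (\<phi> i - \<phi> j))"
      unfolding sum_distrib_left[symmetric]
      by (intro sum.cong refl) (simp only: diff lessThan_iff)
    finally show ?thesis .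
  qed
  ultimately show ?thesis by simp
qed

lemma Z_mult_vec: "Z l *\<^sub>v vec (l + 1) \<phi> = vec l (\<lambda>k. \<phi> (Suc k))"
proof (rule eq_vecI)
  fix k assume k: "k < dim_vec (vec l (\<lambda>k. \<phi> (Suc k)))"
  then have "row (Z l) k = unit_vec (l + 1) (Suc k)"
    by (intro eq_vecI) (auto simp: Z_index unit_vec_def)
  then show "(Z l *\<^sub>v vec (l + 1) \<phi>) $ k = vec l (\<lambda>k. \<phi> (Suc k)) $ k"
    using k by (simp add: scalar_prod_left_unit[of "vec (l + 1) \<phi>" "l + 1"])
qed simp

lemma scalar_prod_Z:
  assumes p: "p \<in> carrier_vec l"
  shows scalar_prod_Z_vec: "p \<bullet> (Z l *\<^sub>v vec (l + 1) \<phi>) = (\<Sum>k<l. p $ k * \<phi> (Suc k))"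
    and scalar_prod_Zp_vec: "p \<bullet> (Zp l *\<^sub>v vec (l + 1) \<phi>) = (\<Sum>k<l. p $ k * \<phi> k)"
  unfolding Z_mult_vec Zp_mult_vec[OF vec_carrier]
  by (simp_all add: scalar_prod_def lessThan_atLeast0)

text \<open>The linear part of the new storage minus \<open>c\<close> times that of the old
  one.\<close>

lemma scalar_prod_shift:
  assumes p: "p \<in> carrier_vec l"
  shows "p \<bullet> ((Zp l - c \<cdot>\<^sub>m Z l) *\<^sub>v vec (l + 1) \<phi>) = (\<Sum>k<l. p $ k * \<phi> k) - c * (\<Sum>k<l. p $ k * \<phi> (Suc k))"
proof -
  let ?\<phi> = "vec (l + 1) \<phi>"
  have Zv: "Z l *\<^sub>v ?\<phi> \<in> carrier_vec l" "Zp l *\<^sub>v ?\<phi> \<in> carrier_vec l"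
    by (rule mult_mat_vec_carrier[OF Z_carrier vec_carrier] mult_mat_vec_carrier[OF Zp_carrier vec_carrier])+
  have s: "(c \<cdot>\<^sub>m Z l) *\<^sub>v ?\<phi> = c \<cdot>\<^sub>v (Z l *\<^sub>v ?\<phi>)"
    by (rule smult_mult_vec) simp
  have "p \<bullet> ((Zp l - c \<cdot>\<^sub>m Z l) *\<^sub>v ?\<phi>) = p \<bullet> (Zp l *\<^sub>v ?\<phi> - c \<cdot>\<^sub>v (Z l *\<^sub>v ?\<phi>))"
    by (simp only: minus_mult_distrib_mat_vec[OF Zp_carrier smult_carrier_mat[OF Z_carrier] vec_carrier] s)
  also have "\<dots> = p \<bullet> (Zp l *\<^sub>v ?\<phi>) - c * (p \<bullet> (Z l *\<^sub>v ?\<phi>))"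
    by (simp only: scalar_prod_minus_distrib[OF p Zv(2) smult_carrier_vec[THEN iffD2, OF Zv(1)]]
        scalar_prod_smult_distrib[OF p Zv(1)])
  finally show ?thesis unfolding scalar_prod_Z[OF p] .
qed

subsection \<open>Dissipation inequalities\<close>

text \<open>\<open>x\<close> is the error relative to the fixed point, while \<open>q\<close> lists
  the remembered points unshifted, with \<open>q 0\<close> the output one step before the time of
  \<open>x\<close>. The current output enters through \<open>x\<close> only.\<close>

definition storage :: "real mat \<Rightarrow> real vec \<Rightarrow> nat \<Rightarrow> nat \<Rightarrow> (real ^ 'd \<Rightarrow> real) \<Rightarrow> (nat \<Rightarrow> real ^ 'd) \<Rightarrow>
    (nat \<Rightarrow> real ^ 'd) \<Rightarrow> real" where
  "storage P p n l f x q =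
     gram_form P (n + 2 * l) (stack n l x (\<lambda>k. q k - minimizer f) (\<lambda>k. grad f (q k)))
     + (\<Sum>k<l. p $ k * (f (q k) - f (minimizer f)))"

lemma stack_cong:
  "(\<And>i. i < n \<Longrightarrow> x i = x' i) \<Longrightarrow> (\<And>k. k < l \<Longrightarrow> a k = a' k) \<Longrightarrow> (\<And>k. k < l \<Longrightarrow> b k = b' k) \<Longrightarrow>
    i < n + 2 * l \<Longrightarrow> stack n l x a b i = stack n l x' a' b' i"
  by (auto simp: stack_def)

lemma gram_form_cong: "(\<And>i. i < N \<Longrightarrow> x i = x' i) \<Longrightarrow> gram_form M N x = gram_form M N x'"
  by (auto simp: gram_form_def intro!: sum.cong)

lemma storage_cong:
  assumes "\<And>i. i < n \<Longrightarrow> x i = x' i" "\<And>k. k < l \<Longrightarrow> q k = q' k"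
  shows "storage P p n l f x q = storage P p n l f x' q'"
  unfolding storage_def using assms
  by (intro arg_cong2[where f = "(+)"] gram_form_cong stack_cong sum.cong) auto

text \<open>
  The interpolation inequalities make the quadratic multiplier term plus its linear companion nonnegative,
  so both can be dropped from the two matrix inequalities.
\<close>

lemma multiplier_nonneg:
  fixes f :: "real ^ 'd \<Rightarrow> real"
  assumes f: "f \<in> F_class m L" and m: "0 < m" "m \<le> L"
    and \<Lambda>: "\<Lambda> \<in> carrier_mat (l + 2) (l + 2)" "0\<^sub>m (l + 2) (l + 2) \<le> \<Lambda>"
  shows "0 \<le> multiplier_form m L l \<Lambda> (\<lambda>i. s i - y) (\<lambda>i. grad f (s i))
    + 2 * (L - m) * (\<Sum>i<l + 2. \<Sum>j<l + 2. \<Lambda> $$ (i, j) * ((f (s i) - c) - (f (s j) - c)))"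
proof -
  have "0 \<le> \<Lambda> $$ (i, j)" if "i < l + 2" "j < l + 2" for i j
    using \<Lambda> that by (auto simp: less_eq_mat_def)
  moreover have "0 \<le> pair_form m L (\<lambda>i. s i - y) (\<lambda>i. grad f (s i)) i j + 2 * (L - m) * (f (s i) - f (s j))" for i j
    using F_class_interpolation[OF f m, of "s i" "s j"] by (simp add: pair_form_def)
  ultimately have "0 \<le> (\<Sum>i<l + 2. \<Sum>j<l + 2. \<Lambda> $$ (i, j) *
      (pair_form m L (\<lambda>i. s i - y) (\<lambda>i. grad f (s i)) i j + 2 * (L - m) * (f (s i) - f (s j))))"
    by (intro sum_nonneg mult_nonneg_nonneg) auto
  also have "\<dots> = multiplier_form m L l \<Lambda> (\<lambda>i. s i - y) (\<lambda>i. grad f (s i))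
    + 2 * (L - m) * (\<Sum>i<l + 2. \<Sum>j<l + 2. \<Lambda> $$ (i, j) * ((f (s i) - c) - (f (s j) - c)))"
    unfolding multiplier_form_def distrib_left sum.distrib sum_distrib_left
    by (simp add: mult.left_commute)
  finally show ?thesis .
qed

section \<open>Matrix inequalities summed over the coordinates\<close>

context
  fixes n l :: nat and A B C P :: "real mat" and m L :: real
  assumes A: "A \<in> carrier_mat n n" and B: "B \<in> carrier_mat n 1" and C: "C \<in> carrier_mat 1 n"
    and P: "P \<in> carrier_mat (n + 2 * l) (n + 2 * l)"
begin

abbreviation (input) "quad_AB Q \<equiv> (lift_AB n l A B C)\<^sup>T * block_diag2 P Q * lift_AB n l A B C"
abbreviation (input) "quad_CD \<Lambda> \<equiv> (lift_CD n l C)\<^sup>T * Pi_mult m L l \<Lambda> * lift_CD n l C"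
abbreviation (input) "quad_I0 \<equiv> (lift_I0 n l)\<^sup>T * P * lift_I0 n l"
abbreviation (input) "quad_X \<equiv> (lift_X n l)\<^sup>T * lift_X n l"
abbreviation (input) "quad_Y \<equiv> (lift_Y l C)\<^sup>T * lift_Y l C"

lemma quad_carriers:
  "Q \<in> carrier_mat (n + 2 * l) (n + 2 * l) \<Longrightarrow> quad_AB Q \<in> carrier_mat (n + 2 * l + 1) (n + 2 * l + 1)"
  "quad_CD \<Lambda> \<in> carrier_mat (n + 2 * l + 1) (n + 2 * l + 1)"
  "quad_I0 \<in> carrier_mat (n + 2 * l + 1) (n + 2 * l + 1)"
  "quad_X \<in> carrier_mat (n + 2 * l + 1) (n + 2 * l + 1)"
  "quad_Y \<in> carrier_mat (n + 2 * l + 1) (n + 2 * l + 1)"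
proof -
  have "dim_col (lift_AB n l A B C) = n + 2 * l + 1"
    unfolding lift_AB_def using carrier_matD(2)[OF lift_A_carrier[OF A C]] by simp
  moreover have "dim_col (lift_CD n l C) = n + 2 * l + 1"
    by (rule carrier_matD(2)[OF lift_CD_carrier[OF C]])
  moreover have "dim_col (lift_I0 n l) = n + 2 * l + 1" "dim_col (lift_X n l) = n + 2 * l + 1"
    "dim_col (lift_Y l C) = n + 2 * l + 1"
    using C by (simp_all add: lift_I0_def lift_X_def lift_Y_def append_cols_def)
  ultimately show
    "Q \<in> carrier_mat (n + 2 * l) (n + 2 * l) \<Longrightarrow> quad_AB Q \<in> carrier_mat (n + 2 * l + 1) (n + 2 * l + 1)"
    "quad_CD \<Lambda> \<in> carrier_mat (n + 2 * l + 1) (n + 2 * l + 1)"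
    "quad_I0 \<in> carrier_mat (n + 2 * l + 1) (n + 2 * l + 1)"
    "quad_X \<in> carrier_mat (n + 2 * l + 1) (n + 2 * l + 1)"
    "quad_Y \<in> carrier_mat (n + 2 * l + 1) (n + 2 * l + 1)"
    by (intro carrier_matI; simp)+
qed

context
  fixes x y u :: "nat \<Rightarrow> real ^ 'd"
  assumes y0: "y 0 = (\<Sum>j<n. C $$ (0, j) *\<^sub>R x j)" and y: "y (Suc l) = 0" and u: "u (Suc l) = 0"
begin

abbreviation (input) "coord z c \<equiv> (\<lambda>i. vec_nth (z i) c)"
abbreviation (input) "lifted_comp c \<equiv> lifted n l (coord x c) (coord y c) (coord u c)"

lemma y0_coord: "vec_nth (y 0) c = (\<Sum>j<n. C $$ (0, j) * vec_nth (x j) c)"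
  unfolding y0 by simp

lemma sum_quad_AB:
  assumes Q: "Q \<in> carrier_mat (n + 2 * l) (n + 2 * l)"
  shows "(\<Sum>c\<in>UNIV. lifted_comp c \<bullet> (quad_AB Q *\<^sub>v lifted_comp c))
    = gram_form P (n + 2 * l) (stack n l (next_state n A B x (u 0)) y u)
      + gram_form Q (n + 2 * l) (stack n l x (\<lambda>k. y (Suc k)) (\<lambda>k. u (Suc k)))"
  unfolding quadratic_lift_AB[where y = "coord y c" and x = "coord x c" for c, OF A B C y0_coord P Q]
    gram_form_components[of P] gram_form_components[of Q] stack_component next_state_component
    sum.distrib ..

lemma sum_quad_CD:
  "(\<Sum>c\<in>UNIV. lifted_comp c \<bullet> (quad_CD \<Lambda> *\<^sub>v lifted_comp c)) = multiplier_form m L l \<Lambda> y u"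
proof -
  have "lifted_comp c \<bullet> (quad_CD \<Lambda> *\<^sub>v lifted_comp c) = multiplier_form m L l \<Lambda> (coord y c) (coord u c)" for c
    using y u by (intro quadratic_lift_CD[where x = "coord x c" and y = "coord y c" and u = "coord u c", OF C y0_coord]) simp_all
  then show ?thesis by (simp only: multiplier_form_components[of m L l \<Lambda> y u])
qed

lemma sum_quad_I0:
  "(\<Sum>c\<in>UNIV. lifted_comp c \<bullet> (quad_I0 *\<^sub>v lifted_comp c))
    = gram_form P (n + 2 * l) (stack n l x (\<lambda>k. y (Suc k)) (\<lambda>k. u (Suc k)))"
  unfolding quadratic_lift_I0[OF P] gram_form_components[of P] stack_component ..

lemma sum_quad_X:
  "(\<Sum>c\<in>UNIV. lifted_comp c \<bullet> (quad_X *\<^sub>v lifted_comp c)) = (\<Sum>i<n. (norm (x i))\<^sup>2)"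
  unfolding quadratic_lift_X power2_norm_eq_inner inner_vec_def
  by (subst sum.swap) (simp add: power2_eq_square)

lemma sum_quad_Y:
  "(\<Sum>c\<in>UNIV. lifted_comp c \<bullet> (quad_Y *\<^sub>v lifted_comp c)) = (norm (y 0))\<^sup>2"
  unfolding quadratic_lift_Y[where y = "coord y c" and x = "coord x c" for c, OF C y0_coord]
    power2_norm_eq_inner inner_vec_def
  by (simp add: power2_eq_square)

lemma lmi_rate_step:
  assumes Q: "Q \<in> carrier_mat (n + 2 * l) (n + 2 * l)" and lmi: "neg_semidef (quad_AB Q + quad_CD \<Lambda>)"
  shows "gram_form P (n + 2 * l) (stack n l (next_state n A B x (u 0)) y u)
    + gram_form Q (n + 2 * l) (stack n l x (\<lambda>k. y (Suc k)) (\<lambda>k. u (Suc k)))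
    + multiplier_form m L l \<Lambda> y u \<le> 0"
proof -
  note c = quad_carriers(1)[OF Q] quad_carriers(2)[of \<Lambda>]
  have "(\<Sum>c\<in>UNIV. lifted_comp c \<bullet> ((quad_AB Q + quad_CD \<Lambda>) *\<^sub>v lifted_comp c)) \<le> 0"
    by (intro sum_nonpos neg_semidefD[OF lmi add_carrier_mat[OF c(2)]] lifted_carrier)
  then show ?thesis
    unfolding quadratic_add[OF c lifted_carrier] sum.distrib sum_quad_AB[OF Q] sum_quad_CD .
qed

lemma lmi_sens_step:
  assumes Q: "Q \<in> carrier_mat (n + 2 * l) (n + 2 * l)" and lmi: "neg_semidef (quad_AB Q + quad_CD \<Lambda> + quad_Y)"
  shows "gram_form P (n + 2 * l) (stack n l (next_state n A B x (u 0)) y u)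
    + gram_form Q (n + 2 * l) (stack n l x (\<lambda>k. y (Suc k)) (\<lambda>k. u (Suc k)))
    + multiplier_form m L l \<Lambda> y u + (norm (y 0))\<^sup>2 \<le> 0"
proof -
  note c = quad_carriers(1)[OF Q] quad_carriers(2)[of \<Lambda>]
  have "(\<Sum>c\<in>UNIV. lifted_comp c \<bullet> ((quad_AB Q + quad_CD \<Lambda> + quad_Y) *\<^sub>v lifted_comp c)) \<le> 0"
    by (intro sum_nonpos neg_semidefD[OF lmi add_carrier_mat[OF quad_carriers(5)]] lifted_carrier)
  then show ?thesis
    unfolding quadratic_add[OF add_carrier_mat[OF c(2)] quad_carriers(5) lifted_carrier]
      quadratic_add[OF c lifted_carrier] sum.distrib sum_quad_AB[OF Q] sum_quad_CD sum_quad_Y .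
qed

text \<open>Although the form of \<open>P\<close> sees only state and past, the multiplier may also
  use the current output and gradient. Hence \<open>P\<close> need not be positive definite by
  itself.\<close>

lemma lmi_rate_lower:
  assumes lmi: "neg_semidef (quad_X - quad_I0 + quad_CD \<Lambda>)"
  shows "(\<Sum>i<n. (norm (x i))\<^sup>2) + multiplier_form m L l \<Lambda> y u
    \<le> gram_form P (n + 2 * l) (stack n l x (\<lambda>k. y (Suc k)) (\<lambda>k. u (Suc k)))"
proof -
  note c = quad_carriers(2-4)
  have eq: "quad_X - quad_I0 = quad_X + - quad_I0" by (rule minus_add_uminus_mat[OF c(3) c(2)])
  have "(\<Sum>c\<in>UNIV. lifted_comp c \<bullet> ((quad_X - quad_I0 + quad_CD \<Lambda>) *\<^sub>v lifted_comp c)) \<le> 0"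
    by (intro sum_nonpos neg_semidefD[OF lmi add_carrier_mat[OF c(1)]] lifted_carrier)
  then show ?thesis
    unfolding eq
      quadratic_add[OF add_carrier_mat[OF uminus_carrier_mat[OF c(2)]] c(1) lifted_carrier]
      quadratic_add[OF c(3) uminus_carrier_mat[OF c(2)] lifted_carrier]
      quadratic_uminus[OF c(2) lifted_carrier] sum.distrib sum_negf sum_quad_X sum_quad_I0 sum_quad_CD
    by simp
qed

lemma lmi_sens_lower:
  assumes lmi: "neg_semidef (- quad_I0 + quad_CD \<Lambda>)"
  shows "multiplier_form m L l \<Lambda> y u
    \<le> gram_form P (n + 2 * l) (stack n l x (\<lambda>k. y (Suc k)) (\<lambda>k. u (Suc k)))"
proof -
  note c = quad_carriers(2-3)
  have "(\<Sum>c\<in>UNIV. lifted_comp c \<bullet> ((- quad_I0 + quad_CD \<Lambda>) *\<^sub>v lifted_comp c)) \<le> 0"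
    by (intro sum_nonpos neg_semidefD[OF lmi add_carrier_mat[OF c(1)]] lifted_carrier)
  then show ?thesis
    unfolding quadratic_add[OF uminus_carrier_mat[OF c(2)] c(1) lifted_carrier]
      quadratic_uminus[OF c(2) lifted_carrier] sum.distrib sum_negf sum_quad_I0 sum_quad_CD
    by simp
qed

end

section \<open>The storage for a function of the class\<close>

context
  fixes f :: "real ^ 'd \<Rightarrow> real" and p :: "real vec"
  assumes f: "f \<in> F_class m L" and m: "0 < m" "m \<le> L" and p: "p \<in> carrier_vec l"
begin

text \<open>A list of points continues beyond \<open>l\<close>; the cut puts the minimizer into the
  slot of the star index, so that all data still come from one function.\<close>

abbreviation (input) "points q \<equiv> (\<lambda>i. if i \<le> l then q i else minimizer f)"
abbreviation (input) "shifted q \<equiv> (\<lambda>i. points q i - minimizer f)"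
abbreviation (input) "grads q \<equiv> (\<lambda>i. grad f (points q i))"

lemma points_star: "shifted q (Suc l) = 0" "grads q (Suc l) = 0"
  using F_class_grad_minimizer[OF f m] by simp_all

text \<open>Two bounds on the same linear multiplier term are combined: the inequality for
  \<open>p\<close> bounds the left-hand side by its negative, and interpolation bounds that negative
  by the quadratic multiplier term.\<close>

lemma linear_multiplier_points:
  assumes \<Lambda>: "\<Lambda> \<in> carrier_mat (l + 2) (l + 2)" "0\<^sub>m (l + 2) (l + 2) \<le> \<Lambda>"
    and W: "W \<in> carrier_mat l (l + 1)" and le: "W\<^sup>T *\<^sub>v p + pi_mult m L l \<Lambda> \<le> 0\<^sub>v (l + 1)"
  shows "p \<bullet> (W *\<^sub>v vec (l + 1) (\<lambda>i. f (points q i) - f (minimizer f)))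
    \<le> multiplier_form m L l \<Lambda> (shifted q) (grads q)"
proof -
  let ?\<phi> = "\<lambda>i. f (points q i) - f (minimizer f)"
  have "p \<bullet> (W *\<^sub>v vec (l + 1) ?\<phi>) + 2 * (L - m) * (\<Sum>i<l + 2. \<Sum>j<l + 2. \<Lambda> $$ (i, j) * (?\<phi> i - ?\<phi> j)) \<le> 0"
    by (rule linear_multiplier_form[OF W p le]) (simp_all add: F_class_minimizer_le[OF f m])
  moreover have "0 \<le> multiplier_form m L l \<Lambda> (shifted q) (grads q)
      + 2 * (L - m) * (\<Sum>i<l + 2. \<Sum>j<l + 2. \<Lambda> $$ (i, j) * (?\<phi> i - ?\<phi> j))"
    by (rule multiplier_nonneg[OF f m \<Lambda>])
  ultimately show ?thesis by simp
qed

text \<open>The storage reads indices below \<open>l\<close>, or at most \<open>l\<close> after the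
  shift, so the cut made by \<open>points\<close> does not change it.\<close>

lemma storage_points:
  "storage P p n l f x q = gram_form P (n + 2 * l) (stack n l x (shifted q) (grads q))
    + (\<Sum>k<l. p $ k * (f (points q k) - f (minimizer f)))"
  "storage P p n l f x (\<lambda>k. q (Suc k)) =
    gram_form P (n + 2 * l) (stack n l x (\<lambda>k. shifted q (Suc k)) (\<lambda>k. grads q (Suc k)))
    + (\<Sum>k<l. p $ k * (f (points q (Suc k)) - f (minimizer f)))"
  unfolding storage_def
  by (intro arg_cong2[where f = "(+)"] gram_form_cong stack_cong sum.cong; simp)+

text \<open>The quadratic multiplier term has opposite roles in the two ingredients: the matrix
  inequality adds it to the change of the quadratic part, and the change of the linear part is at
  most this term. Adding both cancels it.\<close>

lemma storage_rate_step:
  assumes \<Lambda>: "\<Lambda> \<in> carrier_mat (l + 2) (l + 2)" "0\<^sub>m (l + 2) (l + 2) \<le> \<Lambda>"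
    and lmi: "neg_semidef (quad_AB (- \<rho> \<cdot>\<^sub>m P) + quad_CD \<Lambda>)"
    and le: "(Zp l - \<rho> \<cdot>\<^sub>m Z l)\<^sup>T *\<^sub>v p + pi_mult m L l \<Lambda> \<le> 0\<^sub>v (l + 1)"
    and q0: "q 0 - minimizer f = (\<Sum>j<n. C $$ (0, j) *\<^sub>R x j)"
  shows "storage P p n l f (next_state n A B x (grad f (q 0))) q \<le> \<rho> * storage P p n l f x (\<lambda>k. q (Suc k))"
proof -
  have W: "Zp l - \<rho> \<cdot>\<^sub>m Z l \<in> carrier_mat l (l + 1)" by auto
  have y0: "shifted q 0 = (\<Sum>j<n. C $$ (0, j) *\<^sub>R x j)" using q0 by simp
  have u0: "grads q 0 = grad f (q 0)" by simp
  show ?thesis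
    using lmi_rate_step[where Q = "- \<rho> \<cdot>\<^sub>m P" and \<Lambda> = \<Lambda> and x = x and y = "shifted q" and u = "grads q",
        OF y0 points_star[of q] smult_carrier_mat[OF P] lmi]
      linear_multiplier_points[OF \<Lambda> W le, of q]
    unfolding storage_points(2)[where q = q] storage_points(1)[where q = q] scalar_prod_shift[OF p] gram_form_smult[OF P] u0
    by (simp add: distrib_left)
qed

lemma storage_sens_step:
  assumes \<Lambda>: "\<Lambda> \<in> carrier_mat (l + 2) (l + 2)" "0\<^sub>m (l + 2) (l + 2) \<le> \<Lambda>"
    and lmi: "neg_semidef (quad_AB (- P) + quad_CD \<Lambda> + quad_Y)"
    and le: "(Zp l - Z l)\<^sup>T *\<^sub>v p + pi_mult m L l \<Lambda> \<le> 0\<^sub>v (l + 1)"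
    and q0: "q 0 - minimizer f = (\<Sum>j<n. C $$ (0, j) *\<^sub>R x j)"
  shows "storage P p n l f (next_state n A B x (grad f (q 0))) q + (norm (q 0 - minimizer f))\<^sup>2
    \<le> storage P p n l f x (\<lambda>k. q (Suc k))"
proof -
  \<comment> \<open>The factor 1 is made explicit so that the shift identity with a general factor
    applies.\<close>
  have one: "1 \<cdot>\<^sub>m Z l = Z l" by (intro eq_matI) auto
  have W: "Zp l - 1 \<cdot>\<^sub>m Z l \<in> carrier_mat l (l + 1)" by auto
  have le': "(Zp l - 1 \<cdot>\<^sub>m Z l)\<^sup>T *\<^sub>v p + pi_mult m L l \<Lambda> \<le> 0\<^sub>v (l + 1)" using le by (simp only: one)
  have minus: "- P = (- 1) \<cdot>\<^sub>m P" by (intro eq_matI) auto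
  have y0: "shifted q 0 = (\<Sum>j<n. C $$ (0, j) *\<^sub>R x j)" using q0 by simp
  have u0: "grads q 0 = grad f (q 0)" and y0': "shifted q 0 = q 0 - minimizer f" by simp_all
  show ?thesis
    using lmi_sens_step[where Q = "- 1 \<cdot>\<^sub>m P" and \<Lambda> = \<Lambda> and x = x and y = "shifted q" and u = "grads q",
        OF y0 points_star[of q] smult_carrier_mat[OF P] lmi[unfolded minus]]
      linear_multiplier_points[OF \<Lambda> W le', of q]
    unfolding storage_points(2)[where q = q] storage_points(1)[where q = q] scalar_prod_shift[OF p] gram_form_smult[OF P] u0 y0'
    by simp
qed

lemma linear_multiplier_past:
  assumes \<Lambda>: "\<Lambda> \<in> carrier_mat (l + 2) (l + 2)" "0\<^sub>m (l + 2) (l + 2) \<le> \<Lambda>"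
    and le: "- ((Z l)\<^sup>T *\<^sub>v p) + pi_mult m L l \<Lambda> \<le> 0\<^sub>v (l + 1)"
  shows "- (\<Sum>k<l. p $ k * (f (points q (Suc k)) - f (minimizer f)))
    \<le> multiplier_form m L l \<Lambda> (shifted q) (grads q)"
proof -
  let ?\<phi> = "vec (l + 1) (\<lambda>i. f (points q i) - f (minimizer f))"
  have W: "- Z l \<in> carrier_mat l (l + 1)" by auto
  have T: "(- Z l)\<^sup>T *\<^sub>v p = - ((Z l)\<^sup>T *\<^sub>v p)" using p by (intro eq_vecI) auto
  have Zv: "Z l *\<^sub>v ?\<phi> \<in> carrier_vec l" by (rule mult_mat_vec_carrier[OF Z_carrier vec_carrier])
  have "(- Z l) *\<^sub>v ?\<phi> = - (Z l *\<^sub>v ?\<phi>)" by (rule uminus_mult_mat_vec) simp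
  then have "p \<bullet> ((- Z l) *\<^sub>v ?\<phi>) = - (\<Sum>k<l. p $ k * (f (points q (Suc k)) - f (minimizer f)))"
    using p Zv scalar_prod_uminus_right[of p "Z l *\<^sub>v ?\<phi>"]
    by (simp only: scalar_prod_Z[OF p] carrier_vecD)
  then show ?thesis
    using linear_multiplier_points[OF \<Lambda> W, of q] le by (simp only: T)
qed

lemma storage_rate_lower:
  assumes \<Lambda>: "\<Lambda> \<in> carrier_mat (l + 2) (l + 2)" "0\<^sub>m (l + 2) (l + 2) \<le> \<Lambda>"
    and lmi: "neg_semidef (quad_X - quad_I0 + quad_CD \<Lambda>)"
    and le: "- ((Z l)\<^sup>T *\<^sub>v p) + pi_mult m L l \<Lambda> \<le> 0\<^sub>v (l + 1)"
    and q0: "q 0 - minimizer f = (\<Sum>j<n. C $$ (0, j) *\<^sub>R x j)"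
  shows "(\<Sum>i<n. (norm (x i))\<^sup>2) \<le> storage P p n l f x (\<lambda>k. q (Suc k))"
proof -
  have y0: "shifted q 0 = (\<Sum>j<n. C $$ (0, j) *\<^sub>R x j)" using q0 by simp
  show ?thesis
    using lmi_rate_lower[where \<Lambda> = \<Lambda> and x = x and y = "shifted q" and u = "grads q", OF y0 points_star[of q] lmi]
      linear_multiplier_past[OF \<Lambda> le, of q]
    unfolding storage_points(2) by simp
qed

lemma storage_sens_nonneg:
  assumes \<Lambda>: "\<Lambda> \<in> carrier_mat (l + 2) (l + 2)" "0\<^sub>m (l + 2) (l + 2) \<le> \<Lambda>"
    and lmi: "neg_semidef (- quad_I0 + quad_CD \<Lambda>)"
    and le: "- ((Z l)\<^sup>T *\<^sub>v p) + pi_mult m L l \<Lambda> \<le> 0\<^sub>v (l + 1)"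
    and q0: "q 0 - minimizer f = (\<Sum>j<n. C $$ (0, j) *\<^sub>R x j)"
  shows "0 \<le> storage P p n l f x (\<lambda>k. q (Suc k))"
proof -
  have y0: "shifted q 0 = (\<Sum>j<n. C $$ (0, j) *\<^sub>R x j)" using q0 by simp
  show ?thesis
    using lmi_sens_lower[where \<Lambda> = \<Lambda> and x = x and y = "shifted q" and u = "grads q", OF y0 points_star[of q] lmi]
      linear_multiplier_past[OF \<Lambda> le, of q]
    unfolding storage_points(2) by simp
qed

end

end

subsection \<open>Convergence rate\<close>

text \<open>The iterates are extended to negative times by the constant value \<open>s\<close>, which will be the minimizer.\<close>

definition history :: "(nat \<Rightarrow> 'a) \<Rightarrow> 'a \<Rightarrow> nat \<Rightarrow> nat \<Rightarrow> 'a" where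
  "history Y s t k = (if k \<le> t then Y (t - k) else s)"

lemma history_0 [simp]: "history Y s t 0 = Y t"
  and history_Suc_Suc [simp]: "history Y s (Suc t) (Suc k) = history Y s t k"
  and history_0_Suc [simp]: "history Y s 0 (Suc k) = s"
  by (simp_all add: history_def)

section \<open>Perturbation and size of the storage\<close>

lemma gram_form_add_scaled:
  fixes a :: "nat \<Rightarrow> 'a::real_inner"
  shows "gram_form M N (\<lambda>i. a i + h i *\<^sub>R w) = gram_form M N a
    + (\<Sum>i<N. \<Sum>j<N. M $$ (i, j) * (h j * inner (a i) w + h i * inner (a j) w))
    + (norm w)\<^sup>2 * gram_form M N h"
proof -
  have swap: "inner w (a j) = inner (a j) w" for j by (rule inner_commute)
  show ?thesis
    unfolding gram_form_def sum_distrib_left sum.distrib[symmetric] power2_norm_eq_inner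
    by (intro sum.cong refl) (simp add: inner_add_left inner_add_right swap algebra_simps)
qed

text \<open>A crude constant is enough: the rate only asks for a finite supremum, so the constant
  just has to be independent of \<open>a\<close>.\<close>

lemma gram_form_bound:
  fixes a :: "nat \<Rightarrow> 'a::real_inner"
  shows "gram_form M N a \<le> (\<Sum>i<N. \<Sum>j<N. \<bar>M $$ (i, j)\<bar>) * (\<Sum>i<N. (norm (a i))\<^sup>2)"
proof -
  let ?S = "\<Sum>i<N. (norm (a i))\<^sup>2"
  have "M $$ (i, j) * inner (a i) (a j) \<le> \<bar>M $$ (i, j)\<bar> * ?S" if "i < N" "j < N" for i j
  proof -
    have le: "(norm (a k))\<^sup>2 \<le> ?S" if "k < N" for k
      using that by (intro member_le_sum) auto
    have "\<bar>inner (a i) (a j)\<bar> \<le> norm (a i) * norm (a j)" by (rule Cauchy_Schwarz_ineq2)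
    also have "\<dots> \<le> ((norm (a i))\<^sup>2 + (norm (a j))\<^sup>2) / 2"
      using sum_squares_bound[of "norm (a i)" "norm (a j)"] by simp
    also have "\<dots> \<le> ?S" using le[OF that(1)] le[OF that(2)] by simp
    finally have "\<bar>M $$ (i, j)\<bar> * \<bar>inner (a i) (a j)\<bar> \<le> \<bar>M $$ (i, j)\<bar> * ?S"
      by (intro mult_left_mono) auto
    moreover have "M $$ (i, j) * inner (a i) (a j) \<le> \<bar>M $$ (i, j)\<bar> * \<bar>inner (a i) (a j)\<bar>"
      unfolding abs_mult[symmetric] by (rule abs_ge_self)
    ultimately show ?thesis by linarith
  qed
  then show ?thesis
    unfolding gram_form_def sum_distrib_right by (intro sum_mono) auto
qed

lemma lift_H_form:
  assumes B: "B \<in> carrier_mat n 1" and P: "P \<in> carrier_mat (n + 2 * l) (n + 2 * l)"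
  shows "((lift_H l B)\<^sup>T * P * lift_H l B) $$ (0, 0)
    = gram_form P (n + 2 * l) (\<lambda>i. if i < n then B $$ (i, 0) else 0)"
proof -
  let ?N = "n + 2 * l" and ?h = "\<lambda>i. if i < n then B $$ (i, 0) else 0"
  have H: "lift_H l B \<in> carrier_mat ?N 1"
    unfolding lift_H_def mult_2 by (rule append_rows3_carrier[OF B zero_carrier_mat zero_carrier_mat])
  have entry: "lift_H l B $$ (i, 0) = ?h i" if "i < ?N" for i
    using that B by (auto simp: lift_H_def append_rows_def)
  have col: "col (lift_H l B) 0 = vec ?N ?h"
    using H entry by (intro eq_vecI) auto
  have PH: "P * lift_H l B \<in> carrier_mat ?N 1" by (rule mult_carrier_mat[OF P H])
  have "(lift_H l B)\<^sup>T * P * lift_H l B = (lift_H l B)\<^sup>T * (P * lift_H l B)"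
    using H by (intro assoc_mult_mat[OF _ P H]) simp
  also have "\<dots> $$ (0, 0) = col (lift_H l B) 0 \<bullet> col (P * lift_H l B) 0"
    using H PH by simp
  also have "col (P * lift_H l B) 0 = P *\<^sub>v col (lift_H l B) 0"
    by (rule col_mult2[OF P H]) simp
  finally show ?thesis unfolding col scalar_prod_mat_vec[OF P] .
qed

text \<open>The noise reaches only the first \<open>n\<close> entries of the stack, through
  \<open>B\<close>; remembered points, their gradients and the function gaps are unaffected. So the
  form of \<open>P\<close> is expanded around \<open>a\<close> in the direction
  \<open>h\<close>.\<close>

lemma storage_noise:
  fixes x q :: "nat \<Rightarrow> real ^ 'd" and f :: "real ^ 'd \<Rightarrow> real" and v w :: "real ^ 'd" and A :: "real mat"
  assumes B: "B \<in> carrier_mat n 1" and P: "P \<in> carrier_mat (n + 2 * l) (n + 2 * l)"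
  defines "h \<equiv> \<lambda>i. if i < n then B $$ (i, 0) else 0"
    and "a \<equiv> stack n l (next_state n A B x v) (\<lambda>k. q k - minimizer f) (\<lambda>k. grad f (q k))"
  shows "storage P p n l f (next_state n A B x (v + w)) q = storage P p n l f (next_state n A B x v) q
    + (\<Sum>i<n + 2 * l. \<Sum>j<n + 2 * l. P $$ (i, j) * (h j * inner (a i) w + h i * inner (a j) w))
    + (norm w)\<^sup>2 * ((lift_H l B)\<^sup>T * P * lift_H l B) $$ (0, 0)"
proof -
  have "stack n l (next_state n A B x (v + w)) (\<lambda>k. q k - minimizer f) (\<lambda>k. grad f (q k)) = (\<lambda>i. a i + h i *\<^sub>R w)"
    by (auto simp: fun_eq_iff a_def h_def stack_def next_state_def scaleR_add_right)
  then show ?thesis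
    unfolding storage_def lift_H_form[OF B P] h_def[symmetric] a_def[symmetric]
    by (simp add: gram_form_add_scaled)
qed

lemma fixed_pointD:
  assumes "algorithm_form n A B C" "fixed_point A C f \<xi>"
  shows "A \<in> carrier_mat n n" "B \<in> carrier_mat n 1" "C \<in> carrier_mat 1 n"
    and "i < n \<Longrightarrow> \<xi> i = (\<Sum>j<n. A $$ (i, j) *\<^sub>R \<xi> j)" and "minimizer f = (\<Sum>j<n. C $$ (0, j) *\<^sub>R \<xi> j)"
  using assms unfolding algorithm_form_def fixed_point_def out_def by auto

text \<open>The fixed point is reproduced by \<open>A\<close> alone, so the error obeys the same
  recursion with the same input.\<close>

lemma state_error_step:
  fixes \<xi>0 :: "nat \<Rightarrow> real ^ 'd" and w :: "nat \<Rightarrow> real ^ 'd"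
  assumes "algorithm_form n A B C" "fixed_point A C f \<xi>" "i < n"
  defines "e \<equiv> \<lambda>t i. state A B C f w \<xi>0 t i - \<xi> i"
  shows "e (Suc t) i = next_state n A B (e t) (grad f (out C (state A B C f w \<xi>0 t)) + w t) i"
  using fixed_pointD(1)[OF assms(1,2)] fixed_pointD(4)[OF assms(1-3)]
  by (simp add: e_def next_state_def scaleR_diff_right sum_subtractf)

lemma out_error:
  assumes "algorithm_form n A B C" "fixed_point A C f \<xi>"
  shows "out C \<zeta> - minimizer f = (\<Sum>j<n. C $$ (0, j) *\<^sub>R (\<zeta> j - \<xi> j))"
  using fixed_pointD(3,5)[OF assms]
  by (simp add: out_def scaleR_diff_right sum_subtractf)

text \<open>With the whole past at the minimizer, all shifted points, gradients and gaps vanish.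
  This gives a bound proportional to the squared initial error, without an additive
  constant.\<close>

lemma storage_initial:
  assumes f: "f \<in> F_class m L" and m: "0 < m" "m \<le> L"
  shows "storage P p n l f x (\<lambda>_. minimizer f) \<le> (\<Sum>i<n + 2 * l. \<Sum>j<n + 2 * l. \<bar>P $$ (i, j)\<bar>) * (\<Sum>i<n. (norm (x i))\<^sup>2)"
proof -
  let ?a = "stack n l x (\<lambda>k. 0) (\<lambda>k. 0)"
  have "(\<Sum>i<n + 2 * l. (norm (?a i))\<^sup>2) = (\<Sum>i<n. (norm (x i))\<^sup>2)"
    by (intro sum.mono_neutral_cong_right) (auto simp: stack_def)
  then show ?thesis
    using gram_form_bound[of P "n + 2 * l" ?a] by (simp add: storage_def F_class_grad_minimizer[OF f m])
qed

text \<open>The quotient in the definition of the rate stays below \<open>sqrt c\<close> uniformly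
  in the function, the initial state and the time, so \<open>r\<close> belongs to the set whose
  infimum is the rate.\<close>

lemma rate_bound:
  fixes \<xi>s :: "(real ^ 'd \<Rightarrow> real) \<Rightarrow> nat \<Rightarrow> real ^ 'd"
  assumes m: "0 < m" "m \<le> L" and alg: "algorithm_form n A B C"
    and fp: "\<And>f. f \<in> F_class m L \<Longrightarrow> fixed_point A C f (\<xi>s f)"
    and r: "0 < r" and P: "P \<in> carrier_mat (n + 2 * l) (n + 2 * l)" and p: "p \<in> carrier_vec l"
    and \<Lambda>1: "\<Lambda>1 \<in> carrier_mat (l + 2) (l + 2)" "0\<^sub>m (l + 2) (l + 2) \<le> \<Lambda>1"
    and \<Lambda>2: "\<Lambda>2 \<in> carrier_mat (l + 2) (l + 2)" "0\<^sub>m (l + 2) (l + 2) \<le> \<Lambda>2"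
    and lmi1: "neg_semidef ((lift_AB n l A B C)\<^sup>T * block_diag2 P (- (r\<^sup>2) \<cdot>\<^sub>m P) * lift_AB n l A B C
                     + (lift_CD n l C)\<^sup>T * Pi_mult m L l \<Lambda>1 * lift_CD n l C)"
    and le1: "(Zp l - r\<^sup>2 \<cdot>\<^sub>m Z l)\<^sup>T *\<^sub>v p + pi_mult m L l \<Lambda>1 \<le> 0\<^sub>v (l + 1)"
    and lmi2: "neg_semidef ((lift_X n l)\<^sup>T * lift_X n l - (lift_I0 n l)\<^sup>T * P * lift_I0 n l
                     + (lift_CD n l C)\<^sup>T * Pi_mult m L l \<Lambda>2 * lift_CD n l C)"
    and le2: "- ((Z l)\<^sup>T *\<^sub>v p) + pi_mult m L l \<Lambda>2 \<le> 0\<^sub>v (l + 1)"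
  shows "rate A B C \<xi>s (F_class m L) \<le> ereal r"
proof -
  define c where "c = (\<Sum>i<n + 2 * l. \<Sum>j<n + 2 * l. \<bar>P $$ (i, j)\<bar>)"
  have c: "0 \<le> c" unfolding c_def by (intro sum_nonneg) auto
  have ABC: "A \<in> carrier_mat n n" "B \<in> carrier_mat n 1" "C \<in> carrier_mat 1 n"
    using alg by (auto simp: algorithm_form_def)
  have bound: "frob_dist n (state A B C f (\<lambda>_. 0) \<xi>0 t) (\<xi>s f) / (r ^ t * frob_dist n \<xi>0 (\<xi>s f)) \<le> sqrt c"
    if f: "f \<in> F_class m L" for f \<xi>0 t
  proof -
    define Y where "Y t = out C (state A B C f (\<lambda>_. 0) \<xi>0 t)" for t
    define e where "e t i = state A B C f (\<lambda>_. 0) \<xi>0 t i - \<xi>s f i" for t i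
    define V where "V t = storage P p n l f (e t) (\<lambda>k. history Y (minimizer f) t (Suc k))" for t
    note fp = fp[OF f]
    have q0: "history Y (minimizer f) t 0 - minimizer f = (\<Sum>j<n. C $$ (0, j) *\<^sub>R e t j)" for t
      using out_error[OF alg fp] by (simp add: Y_def e_def)
    have step: "V (Suc t) \<le> r\<^sup>2 * V t" for t
    proof -
      \<comment> \<open>Remembering from \<open>Suc t\<close> with index \<open>Suc k\<close> is the
        same as remembering from \<open>t\<close> with index \<open>k\<close>, so the new memory is
        the whole history at \<open>t\<close>.\<close>
      have "e (Suc t) i = next_state n A B (e t) (grad f (Y t)) i" if "i < n" for i
        using state_error_step[OF alg fp that, of "\<lambda>_. 0" \<xi>0 t] by (simp add: e_def[abs_def] Y_def del: state.simps)
      then have "V (Suc t) = storage P p n l f (next_state n A B (e t) (grad f (Y t))) (history Y (minimizer f) t)"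
        unfolding V_def by (intro storage_cong) simp_all
      also have "\<dots> \<le> r\<^sup>2 * V t"
        using storage_rate_step[where q = "history Y (minimizer f) t" and x = "e t", OF ABC P f m p \<Lambda>1 lmi1 le1 q0] by (simp add: V_def)
      finally show ?thesis .
    qed
    have V_le: "V t \<le> r ^ (2 * t) * V 0" for t
    proof (induction t)
      case (Suc t)
      have "V (Suc t) \<le> r\<^sup>2 * V t" by (rule step)
      also have "\<dots> \<le> r\<^sup>2 * (r ^ (2 * t) * V 0)" using Suc by (intro mult_left_mono) auto
      finally show ?case by (simp add: power2_eq_square mult.assoc)
    qed simp
    have frob: "frob_dist n (state A B C f (\<lambda>_. 0) \<xi>0 t) (\<xi>s f) = sqrt (\<Sum>i<n. (norm (e t i))\<^sup>2)" for t
      by (simp add: frob_dist_def L2_set_def e_def)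
    have "(\<Sum>i<n. (norm (e t i))\<^sup>2) \<le> V t"
      using storage_rate_lower[where q = "history Y (minimizer f) t" and x = "e t", OF ABC P f m p \<Lambda>2 lmi2 le2 q0] by (simp add: V_def)
    also have "V t \<le> r ^ (2 * t) * V 0" by (rule V_le)
    also have "\<dots> \<le> r ^ (2 * t) * (c * (\<Sum>i<n. (norm (e 0 i))\<^sup>2))"
      using storage_initial[OF f m, of P p n l "e 0"] r
      by (intro mult_left_mono) (simp_all add: V_def c_def)
    finally have "sqrt (\<Sum>i<n. (norm (e t i))\<^sup>2) \<le> sqrt (r ^ (2 * t) * (c * (\<Sum>i<n. (norm (e 0 i))\<^sup>2)))"
      by (rule real_sqrt_le_mono)
    also have "\<dots> = sqrt c * (r ^ t * sqrt (\<Sum>i<n. (norm (e 0 i))\<^sup>2))"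
    proof -
      have "sqrt (r ^ (2 * t)) = r ^ t" using r by (intro real_sqrt_unique) (auto simp: power_even_eq)
      then show ?thesis by (simp add: real_sqrt_mult)
    qed
    finally have le: "frob_dist n (state A B C f (\<lambda>_. 0) \<xi>0 t) (\<xi>s f) \<le> sqrt c * (r ^ t * frob_dist n \<xi>0 (\<xi>s f))"
      using frob[of t] frob[of 0] by simp
    \<comment> \<open>If the initial error is zero, the quotient is 0 by the convention for division
      by zero and lies below \<open>sqrt c\<close> as well.\<close>
    define D where "D = r ^ t * frob_dist n \<xi>0 (\<xi>s f)"
    have "0 \<le> D"
      using r by (simp add: D_def frob_dist_def L2_set_nonneg)
    then show ?thesis
      using le c unfolding D_def[symmetric] by (cases "D = 0") (simp_all add: divide_le_eq)
  qed
  have n: "dim_row A = n" using ABC by simp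
  have "(SUP f\<in>F_class m L. SUP \<xi>0. SUP t. ereal (frob_dist (dim_row A) (state A B C f (\<lambda>_. 0) \<xi>0 t) (\<xi>s f) /
               (r ^ t * frob_dist (dim_row A) \<xi>0 (\<xi>s f)))) \<le> ereal (sqrt c)"
    unfolding n by (intro SUP_least) (simp add: bound)
  also have "\<dots> < \<infinity>" by simp
  finally show ?thesis
    unfolding rate_def using r by (intro Inf_lower) blast
qed

subsection \<open>Sensitivity\<close>

text \<open>
  Measurability over every index set containing \<open>{..<t}\<close> serves both the whole noise space (\<open>UNIV\<close>) and
  the independence argument (\<open>{..<t}\<close>).
\<close>

definition adapted_L2 :: "(nat \<Rightarrow> real ^ 'd) measure \<Rightarrow> nat \<Rightarrow> ((nat \<Rightarrow> real ^ 'd) \<Rightarrow> real ^ 'd) \<Rightarrow> bool" where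
  "adapted_L2 M t \<Phi> \<longleftrightarrow> (\<forall>I. {..<t} \<subseteq> I \<longrightarrow> \<Phi> \<in> borel_measurable (\<Pi>\<^sub>M s\<in>I. borel)) \<and>
     (\<forall>w w'. (\<forall>s<t. w s = w' s) \<longrightarrow> \<Phi> w = \<Phi> w') \<and> integrable M (\<lambda>w. (norm (\<Phi> w))\<^sup>2)"

lemma adapted_L2_measurable_PiM:
  "adapted_L2 M t \<Phi> \<Longrightarrow> {..<t} \<subseteq> I \<Longrightarrow> \<Phi> \<in> borel_measurable (\<Pi>\<^sub>M s\<in>I. borel)"
  by (simp add: adapted_L2_def)

lemma adapted_L2_cong:
  "adapted_L2 M t \<Phi> \<Longrightarrow> (\<And>s. s < t \<Longrightarrow> w s = w' s) \<Longrightarrow> \<Phi> w = \<Phi> w'"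
  unfolding adapted_L2_def by blast

section \<open>Closure properties of adapted square-integrable variables\<close>

context
  fixes M :: "(nat \<Rightarrow> real ^ 'd) measure" and \<sigma> :: real
  assumes M: "M \<in> noise_dists \<sigma>"
begin

lemma prob_space_noise: "prob_space M"
  using M by (simp add: noise_dists_def)

lemma adapted_L2_measurable: "adapted_L2 M t \<Phi> \<Longrightarrow> \<Phi> \<in> borel_measurable M"
proof -
  assume "adapted_L2 M t \<Phi>"
  then have "\<Phi> \<in> borel_measurable (\<Pi>\<^sub>M s\<in>UNIV. borel)" by (rule adapted_L2_measurable_PiM) simp
  moreover have "sets M = sets (\<Pi>\<^sub>M s\<in>UNIV. borel)" using M by (simp add: noise_dists_def)
  ultimately show ?thesis by (simp cong: measurable_cong_sets)
qed

lemma adapted_L2_integrable: "adapted_L2 M t \<Phi> \<Longrightarrow> integrable M (\<lambda>w. (norm (\<Phi> w))\<^sup>2)"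
  by (simp add: adapted_L2_def)

text \<open>Reduces square integrability to domination by an integrable function; measurability on
  the noise space is the case where the index set is everything.\<close>

lemma adapted_L2_bound:
  assumes meas: "\<And>I. {..<t} \<subseteq> I \<Longrightarrow> \<Phi> \<in> borel_measurable (\<Pi>\<^sub>M s\<in>I. borel)"
    and dep: "\<And>w w'. (\<And>s. s < t \<Longrightarrow> w s = w' s) \<Longrightarrow> \<Phi> w = \<Phi> w'"
    and g: "integrable M g" and bound: "\<And>w. (norm (\<Phi> w))\<^sup>2 \<le> g w"
  shows "adapted_L2 M t \<Phi>"
proof -
  have "\<Phi> \<in> borel_measurable (\<Pi>\<^sub>M s\<in>UNIV. borel)" by (rule meas[OF subset_UNIV])
  moreover have "sets M = sets (\<Pi>\<^sub>M s\<in>UNIV. borel)" using M by (simp add: noise_dists_def)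
  ultimately have "\<Phi> \<in> borel_measurable M" by (simp cong: measurable_cong_sets)
  then have "integrable M (\<lambda>w. (norm (\<Phi> w))\<^sup>2)"
    using bound by (intro Bochner_Integration.integrable_bound[OF g]) (auto intro: order.trans[OF _ abs_ge_self])
  with meas dep show ?thesis unfolding adapted_L2_def by presburger
qed

lemma adapted_L2_const: "adapted_L2 M t (\<lambda>_. c)"
proof -
  interpret prob_space M by (rule prob_space_noise)
  show ?thesis by (simp add: adapted_L2_def)
qed

lemma adapted_L2_mono:
  assumes "adapted_L2 M s \<Phi>" "s \<le> t"
  shows "adapted_L2 M t \<Phi>"
proof -
  have "{..<s} \<subseteq> I" if "{..<t} \<subseteq> I" for I :: "nat set" using that assms(2) by force
  moreover have "\<Phi> w = \<Phi> w'" if "\<forall>r<t. w r = w' r" for w w'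
    using that assms(2) by (intro adapted_L2_cong[OF assms(1)]) simp
  ultimately show ?thesis
    using assms(1) unfolding adapted_L2_def by simp
qed

lemma adapted_L2_scaleR:
  assumes \<Phi>: "adapted_L2 M t \<Phi>"
  shows "adapted_L2 M t (\<lambda>w. c *\<^sub>R \<Phi> w)"
proof (rule adapted_L2_bound)
  show "integrable M (\<lambda>w. c\<^sup>2 * (norm (\<Phi> w))\<^sup>2)"
    using \<Phi> unfolding adapted_L2_def by simp
  show "(norm (c *\<^sub>R \<Phi> w))\<^sup>2 \<le> c\<^sup>2 * (norm (\<Phi> w))\<^sup>2" for w
    by (simp add: power_mult_distrib)
  show "(\<lambda>w. c *\<^sub>R \<Phi> w) \<in> borel_measurable (\<Pi>\<^sub>M s\<in>I. borel)" if "{..<t} \<subseteq> I" for I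
    by (intro borel_measurable_scaleR borel_measurable_const adapted_L2_measurable_PiM[OF \<Phi> that])
  show "c *\<^sub>R \<Phi> w = c *\<^sub>R \<Phi> w'" if "\<And>s. s < t \<Longrightarrow> w s = w' s" for w w'
    using adapted_L2_cong[OF \<Phi> that] by simp
qed

lemma adapted_L2_add:
  assumes "adapted_L2 M t \<Phi>" "adapted_L2 M t \<Psi>"
  shows "adapted_L2 M t (\<lambda>w. \<Phi> w + \<Psi> w)"
proof (rule adapted_L2_bound)
  show "integrable M (\<lambda>w. 2 * (norm (\<Phi> w))\<^sup>2 + 2 * (norm (\<Psi> w))\<^sup>2)"
    using assms unfolding adapted_L2_def by simp
  show "(norm (\<Phi> w + \<Psi> w))\<^sup>2 \<le> 2 * (norm (\<Phi> w))\<^sup>2 + 2 * (norm (\<Psi> w))\<^sup>2" for w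
  proof -
    have "(norm (\<Phi> w + \<Psi> w))\<^sup>2 \<le> (norm (\<Phi> w) + norm (\<Psi> w))\<^sup>2"
      by (intro power_mono norm_triangle_ineq) simp
    also have "\<dots> \<le> 2 * (norm (\<Phi> w))\<^sup>2 + 2 * (norm (\<Psi> w))\<^sup>2"
      using sum_squares_bound[of "norm (\<Phi> w)" "norm (\<Psi> w)"] by (simp add: power2_sum)
    finally show ?thesis .
  qed
  show "(\<lambda>w. \<Phi> w + \<Psi> w) \<in> borel_measurable (\<Pi>\<^sub>M s\<in>I. borel)" if "{..<t} \<subseteq> I" for I
    by (intro borel_measurable_add adapted_L2_measurable_PiM[OF assms(1) that] adapted_L2_measurable_PiM[OF assms(2) that])
  show "\<Phi> w + \<Psi> w = \<Phi> w' + \<Psi> w'" if "\<And>s. s < t \<Longrightarrow> w s = w' s" for w w'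
    using adapted_L2_cong[OF assms(1) that] adapted_L2_cong[OF assms(2) that] by simp
qed

lemma adapted_L2_diff:
  assumes "adapted_L2 M t \<Phi>" "adapted_L2 M t \<Psi>"
  shows "adapted_L2 M t (\<lambda>w. \<Phi> w - \<Psi> w)"
  using adapted_L2_add[OF assms(1) adapted_L2_scaleR[OF assms(2), of "-1"]] by simp

lemma adapted_L2_sum:
  "(\<And>i. i \<in> S \<Longrightarrow> adapted_L2 M t (\<Phi> i)) \<Longrightarrow> adapted_L2 M t (\<lambda>w. \<Sum>i\<in>S. \<Phi> i w)"
  by (induction S rule: infinite_finite_induct) (simp_all add: adapted_L2_const adapted_L2_add)

text \<open>The index is \<open>Suc t\<close>: the variable \<open>w t\<close> is not among the
  coordinates below \<open>t\<close>, on which all quantities at time \<open>t\<close> depend. This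
  gap is what independence exploits.\<close>

lemma adapted_L2_noise: "adapted_L2 M (Suc t) (\<lambda>w. w t)"
  and noise_variance: "(\<integral>w. (norm (w t))\<^sup>2 \<partial>M) \<le> \<sigma>\<^sup>2"
proof -
  have le: "(\<integral>\<^sup>+ w. ennreal ((norm (w t))\<^sup>2) \<partial>M) \<le> ennreal (\<sigma>\<^sup>2)"
    and int: "has_bochner_integral M (\<lambda>w. w t) 0"
    using M by (auto simp: noise_dists_def)
  have meas: "(\<lambda>w. w t) \<in> borel_measurable M"
    using int by (auto simp: has_bochner_integral_iff)
  have "integrable M (\<lambda>w. (norm (w t))\<^sup>2)"
    using meas le by (intro integrableI_bounded) (auto simp: le_less_trans)
  then show "adapted_L2 M (Suc t) (\<lambda>w. w t)"
    unfolding adapted_L2_def by (auto intro!: measurable_component_singleton)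
  show "(\<integral>w. (norm (w t))\<^sup>2 \<partial>M) \<le> \<sigma>\<^sup>2"
    using le meas by (subst integral_eq_nn_integral) (auto simp: enn2real_leI)
qed

lemma integrable_inner_L2:
  assumes "adapted_L2 M s \<Phi>" "adapted_L2 M t \<Psi>"
  shows "integrable M (\<lambda>w. inner (\<Phi> w) (\<Psi> w))"
proof (rule Bochner_Integration.integrable_bound)
  show "integrable M (\<lambda>w. (norm (\<Phi> w))\<^sup>2 + (norm (\<Psi> w))\<^sup>2)"
    using assms unfolding adapted_L2_def by simp
  show "(\<lambda>w. inner (\<Phi> w) (\<Psi> w)) \<in> borel_measurable M"
    using assms[THEN adapted_L2_measurable] by (intro borel_measurable_inner)
  have "norm (inner (\<Phi> w) (\<Psi> w)) \<le> norm ((norm (\<Phi> w))\<^sup>2 + (norm (\<Psi> w))\<^sup>2)" for w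
  proof -
    have "\<bar>inner (\<Phi> w) (\<Psi> w)\<bar> \<le> norm (\<Phi> w) * norm (\<Psi> w)" by (rule Cauchy_Schwarz_ineq2)
    also have "\<dots> \<le> (norm (\<Phi> w))\<^sup>2 + (norm (\<Psi> w))\<^sup>2"
      using sum_squares_bound[of "norm (\<Phi> w)" "norm (\<Psi> w)"] mult_nonneg_nonneg[OF norm_ge_zero norm_ge_zero, of "\<Phi> w" "\<Psi> w"]
      by linarith
    finally show ?thesis by simp
  qed
  then show "AE w in M. norm (inner (\<Phi> w) (\<Psi> w)) \<le> norm ((norm (\<Phi> w))\<^sup>2 + (norm (\<Psi> w))\<^sup>2)"
    by simp
qed

text \<open>\<open>\<Phi>\<close> is a function of the noise before \<open>t\<close>, hence
  independent of \<open>w t\<close>. In each coordinate the expectation of the product factors, and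
  the factor from the noise is zero.\<close>

lemma noise_orthogonal:
  assumes \<Phi>: "adapted_L2 M t \<Phi>"
  shows "(\<integral>w. inner (\<Phi> w) (w t) \<partial>M) = 0"
proof -
  interpret prob_space M by (rule prob_space_noise)
  have ind: "indep_vars (\<lambda>_. borel) (\<lambda>t w. w t) UNIV" and mean: "has_bochner_integral M (\<lambda>w. w t) 0"
    using M by (auto simp: noise_dists_def)
  have \<Phi>_restrict: "\<Phi> (restrict w {..<t}) = \<Phi> w" for w
    by (rule adapted_L2_cong[OF \<Phi>]) simp
  have comp_meas: "(\<lambda>z. vec_nth z c) \<in> borel_measurable borel" for c :: 'd
    by (intro borel_measurable_continuous_onI continuous_intros)
  have \<Phi>c: "(\<lambda>z. vec_nth (\<Phi> z) c) \<in> borel_measurable (\<Pi>\<^sub>M s\<in>{..<t}. borel)" for c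
    by (rule measurable_compose[OF adapted_L2_measurable_PiM[OF \<Phi> order_refl] comp_meas])
  have tc: "(\<lambda>z. vec_nth (z t) c) \<in> borel_measurable (\<Pi>\<^sub>M s\<in>{t}. borel)" for c :: 'd
    by (intro measurable_compose[OF _ comp_meas] measurable_component_singleton) simp
  have int1: "integrable M (\<lambda>w. vec_nth (\<Phi> w) c)" for c
  proof -
    \<comment> \<open>On a probability space square integrability gives integrability, here through
      the product with a constant unit vector.\<close>
    have "integrable M (\<lambda>w. inner (\<Phi> w) (axis c 1))"
      by (rule integrable_inner_L2[OF \<Phi> adapted_L2_const[of 0]])
    then show ?thesis by (simp add: inner_axis)
  qed
  have int2: "integrable M (\<lambda>w. vec_nth (w t) c)" "(\<integral>w. vec_nth (w t) c \<partial>M) = 0" for c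
    using has_bochner_integral_bounded_linear[OF bounded_linear_vec_nth mean, of c]
    by (auto simp: has_bochner_integral_iff)
  have indep: "indep_var borel (\<lambda>w. vec_nth (\<Phi> w) c) borel (\<lambda>w. vec_nth (w t) c)" for c
  proof -
    \<comment> \<open>Grouping the noise into the disjoint blocks before \<open>t\<close> and at
      \<open>t\<close> keeps it independent; \<open>\<Phi>\<close> factors through the first
      block.\<close>
    have "indep_var (\<Pi>\<^sub>M s\<in>{..<t}. borel) (\<lambda>w. restrict (\<lambda>s. w s) {..<t}) (\<Pi>\<^sub>M s\<in>{t}. borel) (\<lambda>w. restrict (\<lambda>s. w s) {t})"
      by (rule indep_var_restrict[OF ind]) auto
    from indep_var_compose[OF this \<Phi>c tc] show ?thesis
      by (simp add: comp_def \<Phi>_restrict)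
  qed
  have "(\<integral>w. inner (\<Phi> w) (w t) \<partial>M) = (\<Sum>c\<in>UNIV. \<integral>w. vec_nth (\<Phi> w) c * vec_nth (w t) c \<partial>M)"
    unfolding inner_vec_def inner_real_def
    by (rule Bochner_Integration.integral_sum) (rule indep_var_integrable[OF indep int1 int2(1)])
  also have "\<dots> = 0"
    by (simp add: indep_var_lebesgue_integral[OF indep int1 int2(1)] int2(2))
  finally show ?thesis .
qed

lemma adapted_L2_stack:
  assumes "\<And>i. adapted_L2 M t (\<lambda>w. x w i)" "\<And>k. adapted_L2 M t (\<lambda>w. a w k)" "\<And>k. adapted_L2 M t (\<lambda>w. b w k)"
  shows "adapted_L2 M t (\<lambda>w. stack n l (x w) (a w) (b w) i)"
  unfolding stack_def using assms by (cases "i < n"; cases "i < n + l") simp_all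

lemma adapted_L2_out:
  "(\<And>i. adapted_L2 M t (\<lambda>w. \<xi> w i)) \<Longrightarrow> adapted_L2 M t (\<lambda>w. out C (\<xi> w))"
  unfolding out_def by (intro adapted_L2_sum adapted_L2_scaleR)

section \<open>Integrability along the noisy trajectory\<close>

context
  fixes f :: "real ^ 'd \<Rightarrow> real" and m L :: real
  assumes f: "f \<in> F_class m L" and m: "0 < m" "m \<le> L"
begin

text \<open>As the gradient vanishes at the minimizer, its norm is at most \<open>L\<close> times
  the distance to the minimizer.\<close>

lemma adapted_L2_grad:
  assumes \<Phi>: "adapted_L2 M t \<Phi>"
  shows "adapted_L2 M t (\<lambda>w. grad f (\<Phi> w))"
proof (rule adapted_L2_bound)
  have gm: "grad f \<in> borel_measurable borel"
    using f by (intro borel_measurable_continuous_onI) (simp add: F_class_def)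
  show "(\<lambda>w. grad f (\<Phi> w)) \<in> borel_measurable (\<Pi>\<^sub>M s\<in>I. borel)" if "{..<t} \<subseteq> I" for I
    by (rule measurable_compose[OF adapted_L2_measurable_PiM[OF \<Phi> that] gm])
  show "grad f (\<Phi> w) = grad f (\<Phi> w')" if "\<And>s. s < t \<Longrightarrow> w s = w' s" for w w'
    by (rule arg_cong[OF adapted_L2_cong[OF \<Phi> that]])
  show "integrable M (\<lambda>w. L\<^sup>2 * (norm (\<Phi> w - minimizer f))\<^sup>2)"
    by (intro integrable_mult_right adapted_L2_integrable[OF adapted_L2_diff[OF \<Phi> adapted_L2_const]])
  show "(norm (grad f (\<Phi> w)))\<^sup>2 \<le> L\<^sup>2 * (norm (\<Phi> w - minimizer f))\<^sup>2" for w
    using F_class_lipschitz[OF f, of "\<Phi> w" "minimizer f"] F_class_grad_minimizer[OF f m]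
    unfolding power_mult_distrib[symmetric] by (intro power_mono) simp_all
qed

text \<open>The gap lies between 0 and a multiple of the squared distance to the minimizer, by the
  descent bound around the minimizer.\<close>

lemma integrable_F_class_gap:
  assumes \<Phi>: "adapted_L2 M t \<Phi>"
  shows "integrable M (\<lambda>w. f (\<Phi> w) - f (minimizer f))"
proof (rule Bochner_Integration.integrable_bound)
  show "integrable M (\<lambda>w. L / 2 * (norm (\<Phi> w - minimizer f))\<^sup>2)"
    by (intro integrable_mult_right adapted_L2_integrable[OF adapted_L2_diff[OF \<Phi> adapted_L2_const]])
  have "continuous_on UNIV f"
    using f unfolding F_class_def
    by (auto intro!: continuous_at_imp_continuous_on differentiable_imp_continuous_within)
  then have fm: "f \<in> borel_measurable borel" by (rule borel_measurable_continuous_onI)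
  show "(\<lambda>w. f (\<Phi> w) - f (minimizer f)) \<in> borel_measurable M"
    by (intro borel_measurable_diff borel_measurable_const
        measurable_compose[OF adapted_L2_measurable[OF \<Phi>] fm])
  have "\<bar>f (\<Phi> w) - f (minimizer f)\<bar> \<le> L / 2 * (norm (\<Phi> w - minimizer f))\<^sup>2" for w
    using F_class_descent[OF f, of "\<Phi> w" "minimizer f"] F_class_grad_minimizer[OF f m]
      F_class_minimizer_le[OF f m, of "\<Phi> w"] by simp
  then show "AE w in M. norm (f (\<Phi> w) - f (minimizer f)) \<le> norm (L / 2 * (norm (\<Phi> w - minimizer f))\<^sup>2)"
    using m by simp
qed

lemma adapted_L2_state: "adapted_L2 M t (\<lambda>w. state A B C f w \<xi>0 t i)"
proof (induction t arbitrary: i)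
  case (Suc t)
  have "adapted_L2 M (Suc t) (\<lambda>w. state A B C f w \<xi>0 t j)" for j
    by (rule adapted_L2_mono[OF Suc]) simp
  then show ?case
    unfolding state.simps
    by (intro adapted_L2_add adapted_L2_sum adapted_L2_scaleR adapted_L2_grad adapted_L2_out adapted_L2_noise)
qed (simp add: adapted_L2_const)

lemma adapted_L2_history:
  "adapted_L2 M t (\<lambda>w. history (\<lambda>s. out C (state A B C f w \<xi>0 s)) (minimizer f) t k)"
  unfolding history_def
  by (cases "k \<le> t") (auto intro!: adapted_L2_const adapted_L2_out
      adapted_L2_mono[OF adapted_L2_state, of "t - k" t])

lemma integrable_storage:
  assumes x: "\<And>i. adapted_L2 M t (\<lambda>w. x w i)" and q: "\<And>k. adapted_L2 M t (\<lambda>w. q w k)"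
  shows "integrable M (\<lambda>w. storage P p n l f (x w) (q w))"
proof -
  have "adapted_L2 M t (\<lambda>w. stack n l (x w) (\<lambda>k. q w k - minimizer f) (\<lambda>k. grad f (q w k)) i)" for i
    by (intro adapted_L2_stack x q adapted_L2_diff adapted_L2_grad adapted_L2_const)
  then show ?thesis
    unfolding storage_def gram_form_def
    by (intro Bochner_Integration.integrable_add Bochner_Integration.integrable_sum integrable_mult_right
        integrable_inner_L2 integrable_F_class_gap[OF q])
qed

end

end

text \<open>
  A negative value under the root would make the bound fail, since the root of a negative number is negative.
  It is excluded by evaluating the storage of \<open>f x = m / 2 * x\<^sup>2\<close> at the state \<open>B\<close> with zero past.
\<close>

lemma lift_H_form_nonneg:
  fixes A B C P :: "real mat"
  assumes ABC: "A \<in> carrier_mat n n" "B \<in> carrier_mat n 1" "C \<in> carrier_mat 1 n"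
    and P: "P \<in> carrier_mat (n + 2 * l) (n + 2 * l)" and m: "0 < m" "m \<le> L" and p: "p \<in> carrier_vec l"
    and \<Lambda>: "\<Lambda> \<in> carrier_mat (l + 2) (l + 2)" "0\<^sub>m (l + 2) (l + 2) \<le> \<Lambda>"
    and lmi: "neg_semidef (- ((lift_I0 n l)\<^sup>T * P * lift_I0 n l) + (lift_CD n l C)\<^sup>T * Pi_mult m L l \<Lambda> * lift_CD n l C)"
    and le: "- ((Z l)\<^sup>T *\<^sub>v p) + pi_mult m L l \<Lambda> \<le> 0\<^sub>v (l + 1)"
  shows "0 \<le> ((lift_H l B)\<^sup>T * P * lift_H l B) $$ (0, 0)"
proof -
  define f where "f x = m / 2 * inner x x" for x :: "real ^ 1"
  have f: "f \<in> F_class m L" and grad: "grad f y = m *\<^sub>R y" and min: "minimizer f = 0" for y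
    unfolding f_def using quadratic_in_F_class[OF m, where 'd = 1] by blast+
  define x :: "nat \<Rightarrow> real ^ 1" where "x i = (if i < n then B $$ (i, 0) else 0) *\<^sub>R axis 1 1" for i
  \<comment> \<open>The value at 0 is the current output of the state \<open>x\<close>, as the
    matrix inequality prescribes; the storage itself sees only the zero past.\<close>
  define q where "q k = (if k = 0 then (\<Sum>j<n. C $$ (0, j) *\<^sub>R x j) else 0)" for k :: nat
  have "0 \<le> storage P p n l f x (\<lambda>k. q (Suc k))"
    by (rule storage_sens_nonneg[OF ABC P f m p \<Lambda> lmi le]) (simp add: q_def min)
  also have "\<dots> = gram_form P (n + 2 * l) (stack n l x (\<lambda>_. 0) (\<lambda>_. 0))"
    by (simp add: storage_def q_def grad min)
  also have "\<dots> = gram_form P (n + 2 * l) (\<lambda>i. if i < n then B $$ (i, 0) else 0)"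
    unfolding gram_form_def by (intro sum.cong refl) (simp add: stack_def x_def inner_axis_axis)
  also have "\<dots> = ((lift_H l B)\<^sup>T * P * lift_H l B) $$ (0, 0)"
    by (rule lift_H_form[OF ABC(2) P, symmetric])
  finally show ?thesis .
qed

text \<open>Expected storage falls in each step by the expected squared output error and rises by at
  most \<open>b * \<sigma>\<^sup>2\<close>. Telescoping bounds the accumulated error up to the
  initial storage, whose share vanishes after division by \<open>T\<close>.\<close>

lemma sens_bound:
  fixes \<xi>s :: "(real ^ 'd \<Rightarrow> real) \<Rightarrow> nat \<Rightarrow> real ^ 'd"
  assumes m: "0 < m" "m \<le> L" and \<sigma>: "0 < \<sigma>" and alg: "algorithm_form n A B C"
    and fp: "\<And>f. f \<in> F_class m L \<Longrightarrow> fixed_point A C f (\<xi>s f)"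
    and P: "P \<in> carrier_mat (n + 2 * l) (n + 2 * l)" and p: "p \<in> carrier_vec l"
    and \<Lambda>1: "\<Lambda>1 \<in> carrier_mat (l + 2) (l + 2)" "0\<^sub>m (l + 2) (l + 2) \<le> \<Lambda>1"
    and \<Lambda>2: "\<Lambda>2 \<in> carrier_mat (l + 2) (l + 2)" "0\<^sub>m (l + 2) (l + 2) \<le> \<Lambda>2"
    and lmi1: "neg_semidef ((lift_AB n l A B C)\<^sup>T * block_diag2 P (- P) * lift_AB n l A B C
                     + (lift_CD n l C)\<^sup>T * Pi_mult m L l \<Lambda>1 * lift_CD n l C
                     + (lift_Y l C)\<^sup>T * lift_Y l C)"
    and le1: "(Zp l - Z l)\<^sup>T *\<^sub>v p + pi_mult m L l \<Lambda>1 \<le> 0\<^sub>v (l + 1)"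
    and lmi2: "neg_semidef (- ((lift_I0 n l)\<^sup>T * P * lift_I0 n l)
                     + (lift_CD n l C)\<^sup>T * Pi_mult m L l \<Lambda>2 * lift_CD n l C)"
    and le2: "- ((Z l)\<^sup>T *\<^sub>v p) + pi_mult m L l \<Lambda>2 \<le> 0\<^sub>v (l + 1)"
  shows "sens \<sigma> A B C (F_class m L :: (real ^ 'd \<Rightarrow> real) set)
              \<le> ereal (sqrt (((lift_H l B)\<^sup>T * P * lift_H l B) $$ (0, 0)))"
proof -
  define b where "b = ((lift_H l B)\<^sup>T * P * lift_H l B) $$ (0, 0)"
  have ABC: "A \<in> carrier_mat n n" "B \<in> carrier_mat n 1" "C \<in> carrier_mat 1 n"
    using alg by (auto simp: algorithm_form_def)
  have b: "0 \<le> b"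
    unfolding b_def by (rule lift_H_form_nonneg[OF ABC P m p \<Lambda>2 lmi2 le2])
  have "limsup (\<lambda>T. ereal (sqrt (\<integral>w. 1 / (\<sigma>\<^sup>2 * real T) *
       (\<Sum>t<T. (norm (out C (state A B C f w \<xi>0 t) - minimizer f))\<^sup>2) \<partial>M))) \<le> ereal (sqrt b)"
    if f: "f \<in> F_class m L" and M: "M \<in> noise_dists \<sigma>" for f :: "real ^ 'd \<Rightarrow> real" and \<xi>0 M
  proof -
    interpret prob_space M by (rule prob_space_noise[OF M])
    note fp = fp[OF f]
    define Y where "Y w t = out C (state A B C f w \<xi>0 t)" for w t
    define e where "e w t i = state A B C f w \<xi>0 t i - \<xi>s f i" for w t i
    define q where "q w t = history (Y w) (minimizer f) t" for w t
    define V where "V t w = storage P p n l f (e w t) (\<lambda>k. q w t (Suc k))" for t w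
    \<comment> \<open>The storage after a step without the current noise: the deterministic
      dissipation inequality applies to it, and \<open>V (Suc t)\<close> differs from it by
      \<open>X\<close> and the squared-noise term.\<close>
    define V' where "V' t w = storage P p n l f (next_state n A B (e w t) (grad f (Y w t))) (q w t)" for t w
    define a where "a t w = stack n l (next_state n A B (e w t) (grad f (Y w t)))
      (\<lambda>k. q w t k - minimizer f) (\<lambda>k. grad f (q w t k))" for t w
    define h where "h i = (if i < n then B $$ (i, 0) else 0)" for i
    define X where "X t w = (\<Sum>i<n + 2 * l. \<Sum>j<n + 2 * l.
      P $$ (i, j) * (h j * inner (a t w i) (w t) + h i * inner (a t w j) (w t)))" for t w

    have adapted_e: "adapted_L2 M t (\<lambda>w. e w t i)" for t i
      unfolding e_def by (intro adapted_L2_diff[OF M] adapted_L2_state[OF M f m] adapted_L2_const[OF M])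
    have adapted_Y: "adapted_L2 M t (\<lambda>w. Y w t)" for t
      unfolding Y_def by (intro adapted_L2_out[OF M] adapted_L2_state[OF M f m])
    have adapted_q: "adapted_L2 M t (\<lambda>w. q w t k)" for t k
      unfolding q_def Y_def by (rule adapted_L2_history[OF M f m])
    have adapted_next: "adapted_L2 M t (\<lambda>w. next_state n A B (e w t) (grad f (Y w t)) i)" for t i
      unfolding next_state_def
      by (intro adapted_L2_add[OF M] adapted_L2_sum[OF M] adapted_L2_scaleR[OF M] adapted_e
          adapted_L2_grad[OF M f m] adapted_Y)
    have adapted_a: "adapted_L2 M t (\<lambda>w. a t w i)" for t i
      unfolding a_def
      by (intro adapted_L2_stack[OF M] adapted_next adapted_L2_diff[OF M] adapted_L2_grad[OF M f m]
          adapted_L2_const[OF M] adapted_q)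
    have int_q: "integrable M (\<lambda>w. (norm (Y w t - minimizer f))\<^sup>2)" for t
      by (rule adapted_L2_integrable[OF M adapted_L2_diff[OF M adapted_Y adapted_L2_const[OF M]]])
    have int_V: "integrable M (V t)" for t
      unfolding V_def
      by (intro integrable_storage[OF M f m, where t = t] adapted_e adapted_q)
    have int_V': "integrable M (V' t)" for t
      unfolding V'_def by (intro integrable_storage[OF M f m, where t = t] adapted_next adapted_q)
    have int_aw: "integrable M (\<lambda>w. inner (a t w i) (w t))" for t i
      by (rule integrable_inner_L2[OF M adapted_a adapted_L2_noise[OF M]])
    have int_X: "integrable M (X t)" and mean_X: "(\<integral>w. X t w \<partial>M) = 0" for t
      unfolding X_def using int_aw
      by (simp_all add: Bochner_Integration.integral_sum noise_orthogonal[OF M adapted_a])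
    have int_w: "integrable M (\<lambda>w. (norm (w t))\<^sup>2)" for t
      by (rule adapted_L2_integrable[OF M adapted_L2_noise[OF M]])

    have q0: "q w t 0 - minimizer f = (\<Sum>j<n. C $$ (0, j) *\<^sub>R e w t j)" for w t
      using out_error[OF alg fp] by (simp add: q_def Y_def e_def)
    have V_nonneg: "0 \<le> V t w" for t w
      unfolding V_def by (rule storage_sens_nonneg[where q = "q w t" and x = "e w t", OF ABC P f m p \<Lambda>2 lmi2 le2 q0])
    have V'_le: "V' t w + (norm (Y w t - minimizer f))\<^sup>2 \<le> V t w" for t w
      using storage_sens_step[where q = "q w t" and x = "e w t", OF ABC P f m p \<Lambda>1 lmi1 le1 q0] by (simp add: V_def V'_def q_def)
    have V_Suc: "V (Suc t) w = V' t w + X t w + (norm (w t))\<^sup>2 * b" for t w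
    proof -
      have "e w (Suc t) i = next_state n A B (e w t) (grad f (Y w t) + w t) i" if "i < n" for i
        using state_error_step[OF alg fp that, of w \<xi>0 t] by (simp add: e_def[abs_def] Y_def del: state.simps)
      then have "V (Suc t) w = storage P p n l f (next_state n A B (e w t) (grad f (Y w t) + w t)) (q w t)"
        unfolding V_def q_def by (intro storage_cong) simp_all
      then show ?thesis
        unfolding storage_noise[OF ABC(2) P] V'_def X_def a_def h_def b_def .
    qed
    have step: "(\<integral>w. (norm (Y w t - minimizer f))\<^sup>2 \<partial>M) + (\<integral>w. V (Suc t) w \<partial>M) \<le> (\<integral>w. V t w \<partial>M) + b * \<sigma>\<^sup>2" for t
    proof -
      have "(\<integral>w. V (Suc t) w \<partial>M) = (\<integral>w. V' t w \<partial>M) + (\<integral>w. (norm (w t))\<^sup>2 \<partial>M) * b"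
        unfolding V_Suc using int_V' int_X int_w mean_X by simp
      moreover have "(\<integral>w. V' t w \<partial>M) + (\<integral>w. (norm (Y w t - minimizer f))\<^sup>2 \<partial>M) \<le> (\<integral>w. V t w \<partial>M)"
      proof -
        have "(\<integral>w. V' t w + (norm (Y w t - minimizer f))\<^sup>2 \<partial>M) \<le> (\<integral>w. V t w \<partial>M)"
          by (intro integral_mono Bochner_Integration.integrable_add int_V' int_q int_V V'_le)
        then show ?thesis by (simp only: Bochner_Integration.integral_add[OF int_V' int_q])
      qed
      \<comment> \<open>Here the sign of \<open>b\<close> matters: the variance is only bounded from
        above.\<close>
      moreover have "(\<integral>w. (norm (w t))\<^sup>2 \<partial>M) * b \<le> \<sigma>\<^sup>2 * b"
        using noise_variance[OF M] b by (rule mult_right_mono)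
      ultimately show ?thesis by (simp add: mult.commute)
    qed
    define v0 where "v0 = (\<integral>w. V 0 w \<partial>M)"
    have telescope: "(\<Sum>t<T. \<integral>w. (norm (Y w t - minimizer f))\<^sup>2 \<partial>M) + (\<integral>w. V T w \<partial>M) \<le> v0 + real T * (b * \<sigma>\<^sup>2)" for T
    proof (induction T)
      case (Suc T)
      then show ?case using step[of T] by (simp add: algebra_simps)
    qed (simp add: v0_def)
    have bound: "(\<integral>w. 1 / (\<sigma>\<^sup>2 * real T) * (\<Sum>t<T. (norm (Y w t - minimizer f))\<^sup>2) \<partial>M)
        \<le> v0 / \<sigma>\<^sup>2 / real T + b" if T: "0 < T" for T
    proof -
      have "(\<integral>w. 1 / (\<sigma>\<^sup>2 * real T) * (\<Sum>t<T. (norm (Y w t - minimizer f))\<^sup>2) \<partial>M)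
          = 1 / (\<sigma>\<^sup>2 * real T) * (\<Sum>t<T. \<integral>w. (norm (Y w t - minimizer f))\<^sup>2 \<partial>M)"
        using int_q by (simp add: Bochner_Integration.integral_sum)
      also have "\<dots> \<le> 1 / (\<sigma>\<^sup>2 * real T) * (v0 + real T * (b * \<sigma>\<^sup>2))"
      proof (rule mult_left_mono)
        \<comment> \<open>The final storage may be dropped from the telescoped sum; this is where
          the second pair of inequalities enters the averaging.\<close>
        have "0 \<le> (\<integral>w. V T w \<partial>M)" by (intro Bochner_Integration.integral_nonneg V_nonneg)
        then show "(\<Sum>t<T. \<integral>w. (norm (Y w t - minimizer f))\<^sup>2 \<partial>M) \<le> v0 + real T * (b * \<sigma>\<^sup>2)"
          using telescope[of T] by linarith
      qed simp
      also have "\<dots> = v0 / \<sigma>\<^sup>2 / real T + b" using T \<sigma> by (simp add: field_simps)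
      finally show ?thesis .
    qed
    have "limsup (\<lambda>T. ereal (sqrt (\<integral>w. 1 / (\<sigma>\<^sup>2 * real T) * (\<Sum>t<T. (norm (Y w t - minimizer f))\<^sup>2) \<partial>M)))
        \<le> limsup (\<lambda>T. ereal (sqrt (v0 / \<sigma>\<^sup>2 / real T + b)))"
      \<comment> \<open>The limit superior only sees large \<open>T\<close>, so the restriction to
        positive \<open>T\<close> is harmless.\<close>
      using bound by (intro Limsup_mono eventually_mono[OF eventually_gt_at_top[of 0]]) simp
    also have "\<dots> = ereal (sqrt b)"
    proof (rule lim_imp_Limsup)
      have "(\<lambda>T. v0 / \<sigma>\<^sup>2 / real T + b) \<longlonglongrightarrow> 0 + b"
        by (intro tendsto_add lim_const_over_n tendsto_const)
      then show "(\<lambda>T. ereal (sqrt (v0 / \<sigma>\<^sup>2 / real T + b))) \<longlonglongrightarrow> ereal (sqrt b)"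
        by (intro tendsto_ereal tendsto_real_sqrt) simp
    qed simp
    finally show ?thesis by (simp only: Y_def)
  qed
  then show ?thesis unfolding sens_def b_def by (intro SUP_least)
qed

theorem theorem4p5:
  fixes m L \<sigma> :: real and n l :: nat and A B C :: "real mat"
    and \<xi>s :: "(real ^ 'd \<Rightarrow> real) \<Rightarrow> nat \<Rightarrow> real ^ 'd"
  assumes "0 < m" "m \<le> L" "0 < \<sigma>"
    and "algorithm_form n A B C"
    and "\<And>f. f \<in> F_class m L \<Longrightarrow> fixed_point A C f (\<xi>s f)"
  shows
    "(\<forall>r P p \<Lambda>1 \<Lambda>2. 0 < r \<and>
        P \<in> carrier_mat (n + 2 * l) (n + 2 * l) \<and> P\<^sup>T = P \<and> p \<in> carrier_vec l \<and>
        \<Lambda>1 \<in> carrier_mat (l + 2) (l + 2) \<and> 0\<^sub>m (l + 2) (l + 2) \<le> \<Lambda>1 \<and>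
        \<Lambda>2 \<in> carrier_mat (l + 2) (l + 2) \<and> 0\<^sub>m (l + 2) (l + 2) \<le> \<Lambda>2 \<and>
        neg_semidef ((lift_AB n l A B C)\<^sup>T * block_diag2 P (- (r\<^sup>2) \<cdot>\<^sub>m P) * lift_AB n l A B C
                     + (lift_CD n l C)\<^sup>T * Pi_mult m L l \<Lambda>1 * lift_CD n l C) \<and>
        (Zp l - r\<^sup>2 \<cdot>\<^sub>m Z l)\<^sup>T *\<^sub>v p + pi_mult m L l \<Lambda>1 \<le> 0\<^sub>v (l + 1) \<and>
        neg_semidef ((lift_X n l)\<^sup>T * lift_X n l - (lift_I0 n l)\<^sup>T * P * lift_I0 n l
                     + (lift_CD n l C)\<^sup>T * Pi_mult m L l \<Lambda>2 * lift_CD n l C) \<and>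
        - ((Z l)\<^sup>T *\<^sub>v p) + pi_mult m L l \<Lambda>2 \<le> 0\<^sub>v (l + 1)
        \<longrightarrow> rate A B C \<xi>s (F_class m L) \<le> ereal r) \<and>
     (\<forall>P p \<Lambda>1 \<Lambda>2.
        P \<in> carrier_mat (n + 2 * l) (n + 2 * l) \<and> P\<^sup>T = P \<and> p \<in> carrier_vec l \<and>
        \<Lambda>1 \<in> carrier_mat (l + 2) (l + 2) \<and> 0\<^sub>m (l + 2) (l + 2) \<le> \<Lambda>1 \<and>
        \<Lambda>2 \<in> carrier_mat (l + 2) (l + 2) \<and> 0\<^sub>m (l + 2) (l + 2) \<le> \<Lambda>2 \<and>
        neg_semidef ((lift_AB n l A B C)\<^sup>T * block_diag2 P (- P) * lift_AB n l A B C
                     + (lift_CD n l C)\<^sup>T * Pi_mult m L l \<Lambda>1 * lift_CD n l C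
                     + (lift_Y l C)\<^sup>T * lift_Y l C) \<and>
        (Zp l - Z l)\<^sup>T *\<^sub>v p + pi_mult m L l \<Lambda>1 \<le> 0\<^sub>v (l + 1) \<and>
        neg_semidef (- ((lift_I0 n l)\<^sup>T * P * lift_I0 n l)
                     + (lift_CD n l C)\<^sup>T * Pi_mult m L l \<Lambda>2 * lift_CD n l C) \<and>
        - ((Z l)\<^sup>T *\<^sub>v p) + pi_mult m L l \<Lambda>2 \<le> 0\<^sub>v (l + 1)
        \<longrightarrow> sens \<sigma> A B C (F_class m L :: (real ^ 'd \<Rightarrow> real) set)
              \<le> ereal (sqrt (((lift_H l B)\<^sup>T * P * lift_H l B) $$ (0, 0))))"
  by (intro conjI allI impI; elim conjE)
    (rule rate_bound[OF assms(1,2,4,5)] sens_bound[OF assms]; assumption)+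

end
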